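(* Let $(G,\omega,\mu)$ be a weighted, stochastically complete, infinite graph with $\lambda_1(G)>0$, and let $q>1$. Let $u_0\in\ell^\infty(G)$, $u_0\ge 0$, $u_0\not\equiv 0$ in $G$. Let $h$ be a non-negative, locally integrable function on $[0,+\infty)$ and define $H:[0,+\infty)\to[0,+\infty)$ by $H(t):=\int_0^t h(s)\,ds$. Suppose that, for some $\epsilon\in(0,\lambda_1(G))$, $$\lim_{t\to+\infty}\frac{[H(t)]^{\frac{1}{q-1}}}{e^{[\lambda_1(G)+\epsilon]t}}=+\infty .$$ Then any solution $u$ of the problem $$u_t=\Delta u+h(t)u^q \ \text{ in } G\times(0,T),\qquad u=u_0 \ \text{ in } G\times\{0\},$$ blows up in finite time; that is, if $u:G\times(0,\tau_{\max})\to[0,+\infty)$, $\tau_{\max}\in(0,+\infty]$, is a maximal mild solution, then $\tau_{\max}<+\infty$ and $\lim_{t\to\tau_{\max}^-}\|u(t)\|_{\ell^\infty(G)}=+\infty$.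
   Context: Weighted infinite graph: $G$ is a countable infinite set, $\mu:G\to(0,+\infty)$ is a (node) measure, and $\omega:G\times G\to[0,+\infty)$ is an edge weight with $\omega(x,y)=\omega(y,x)$, $\omega(x,x)=0$ and $\sum_{y\in G}\omega(x,y)<\infty$ for all $x,y\in G$. Write $x\sim y$ if $\omega(x,y)>0$. The graph is always assumed locally finite (each $x$ has finitely many $y\sim x$), connected (any two distinct vertices are joined by a path $x_0\sim x_1\sim\dots\sim x_n$) and undirected. Laplacian: $\Delta f(x)=\frac1{\mu(x)}\sum_{y\in G}[f(y)-f(x)]\omega(x,y)$. $\ell^\infty(G)$ is the space of bounded functions $G\to\mathbb R$ with the sup norm. $p:G\times G\times(0,+\infty)\to(0,+\infty)$ is the (minimal) heat kernel of $(G,\omega,\mu)$, i.e. the kernel, with respect to $\mu$, of the heat semigroup $e^{t\Delta}$: $(e^{t\Delta}u_0)(x)=\sum_{y\in G}p(x,y,t)u_0(y)\mu(y)$ for $u_0\in\ell^\infty(G)$ (the smallest positive fundamental solution of $\partial_t p=\Delta p$ with $p(x,y,0^+)=\mathbf 1_{x=y}/\mu(x)$). $\lambda_1(G)$ is the infimum of the $L^2$-spectrum of $-\Delta$, i.e. the infimum of $\frac{\frac12\sum_{x,y}\omega(x,y)(f(y)-f(x))^2}{\sum_x f(x)^2\mu(x)}$ over nonzero finitely supported $f:G\to\mathbb R$. The graph is stochastically complete if $\sum_{y\in G}p(x,y,t)\mu(y)=1$ for all $x\in G$, $t>0$. Mild solution: a nonnegative $u:G\times(0,\tau)\to\mathbb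 R$, $u\in L^\infty((0,\tau),\ell^\infty(G))$, is a mild solution in $G\times(0,\tau)$ if for every $x\in G$, $t\in(0,\tau)$, $$u(x,t)=\sum_{y\in G}p(x,y,t)u_0(y)\mu(y)+\int_0^t\sum_{y\in G}p(x,y,t-s)h(s)u(y,s)^q\mu(y)\,ds .$$ A solution blows up in finite time if there exists $\tau>0$ with $\lim_{t\to\tau^-}\|u(t)\|_{\ell^\infty(G)}=+\infty$. A maximal mild solution on $G\times(0,\tau_{\max})$ is a function that is a mild solution in $G\times(0,\tau)$ for every finite $\tau\in(0,\tau_{\max}]$ if $\tau<\tau_{\max}$ and that is not the restriction of a mild solution in $G\times(0,\tau')$ for any $\tau'>\tau_{\max}$. *)

theory Defs
  imports "HOL-Analysis.Analysis"
begin

text \<open>The vertex set \<open>G\<close> is the type \<open>'a\<close>; \<open>\<omega>\<close> is the edge weight and \<open>\<mu>\<close> the node measure.\<close>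

locale weighted_graph =
  fixes \<omega> :: "'a \<Rightarrow> 'a \<Rightarrow> real" and \<mu> :: "'a \<Rightarrow> real"
  assumes countable_vertices: "countable (UNIV :: 'a set)"
    and infinite_vertices: "infinite (UNIV :: 'a set)"
    and measure_pos: "\<And>x. \<mu> x > 0"
    and weight_nonneg: "\<And>x y. \<omega> x y \<ge> 0"
    and weight_sym: "\<And>x y. \<omega> x y = \<omega> y x"
    and weight_diag: "\<And>x. \<omega> x x = 0"
    and weight_summable: "\<And>x. (\<lambda>y. \<omega> x y) summable_on UNIV"
    and locally_finite: "\<And>x. finite {y. \<omega> x y > 0}"
    and connected_vertices: "\<And>x y. (\<lambda>a b. \<omega> a b > 0)\<^sup>*\<^sup>* x y"

definition laplacian :: "('a \<Rightarrow> 'a \<Rightarrow> real) \<Rightarrow> ('a \<Rightarrow> real) \<Rightarrow> ('a \<Rightarrow> real) \<Rightarrow> 'a \<Rightarrow> real" where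
  "laplacian \<omega> \<mu> f x = (1 / \<mu> x) * (\<Sum>\<^sub>\<infinity>y. (f y - f x) * \<omega> x y)"

text \<open>The bottom of the \<open>L\<^sup>2\<close>-spectrum of minus the Laplacian, given by its Rayleigh quotient over
  the nonzero finitely supported functions.\<close>

definition bottom_spectrum :: "('a \<Rightarrow> 'a \<Rightarrow> real) \<Rightarrow> ('a \<Rightarrow> real) \<Rightarrow> real" where
  "bottom_spectrum \<omega> \<mu> =
     (INF f \<in> {f. finite {x. f x \<noteq> 0} \<and> (\<exists>x. f x \<noteq> 0)}.
        (1 / 2 * (\<Sum>\<^sub>\<infinity>(x, y)\<in>UNIV. \<omega> x y * (f y - f x)\<^sup>2)) / (\<Sum>\<^sub>\<infinity>x. (f x)\<^sup>2 * \<mu> x))"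

text \<open>Kernels are functions of \<open>x\<close>, \<open>y\<close>, \<open>t\<close>; only their values at times \<open>t > 0\<close> matter.\<close>

definition positive_fundamental_solution ::
    "('a \<Rightarrow> 'a \<Rightarrow> real) \<Rightarrow> ('a \<Rightarrow> real) \<Rightarrow> ('a \<Rightarrow> 'a \<Rightarrow> real \<Rightarrow> real) \<Rightarrow> bool" where
  "positive_fundamental_solution \<omega> \<mu> p \<longleftrightarrow>
     (\<forall>x y t. t > 0 \<longrightarrow> p x y t > 0) \<and>
     (\<forall>x y t. t > 0 \<longrightarrow>
        ((\<lambda>s. p x y s) has_real_derivative laplacian \<omega> \<mu> (\<lambda>z. p z y t) x) (at t)) \<and>
     (\<forall>x y. ((\<lambda>t. p x y t) \<longlongrightarrow> (if x = y then 1 / \<mu> x else 0)) (at_right 0))"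

definition heat_kernel ::
    "('a \<Rightarrow> 'a \<Rightarrow> real) \<Rightarrow> ('a \<Rightarrow> real) \<Rightarrow> ('a \<Rightarrow> 'a \<Rightarrow> real \<Rightarrow> real) \<Rightarrow> bool" where
  "heat_kernel \<omega> \<mu> p \<longleftrightarrow>
     positive_fundamental_solution \<omega> \<mu> p \<and>
     (\<forall>p'. positive_fundamental_solution \<omega> \<mu> p' \<longrightarrow> (\<forall>x y t. t > 0 \<longrightarrow> p x y t \<le> p' x y t))"

definition stochastically_complete ::
    "('a \<Rightarrow> real) \<Rightarrow> ('a \<Rightarrow> 'a \<Rightarrow> real \<Rightarrow> real) \<Rightarrow> bool" where
  "stochastically_complete \<mu> p \<longleftrightarrow>
     (\<forall>x t. t > 0 \<longrightarrow> ((\<lambda>y. p x y t * \<mu> y) has_sum 1) UNIV)"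

text \<open>The sup norm, with value \<open>\<infinity>\<close> outside of the space of bounded functions.\<close>

definition linf_norm :: "('a \<Rightarrow> real) \<Rightarrow> ereal" where
  "linf_norm f = (SUP x. ereal \<bar>f x\<bar>)"

text \<open>Membership of \<open>u\<close> in \<open>L\<^sup>\<infinity>((0,\<tau>), \<ell>\<^sup>\<infinity>(G))\<close> is rendered as measurability in time at each
  vertex together with an essential bound on the sup norm. (Strong measurability into the
  nonseparable space \<open>\<ell>\<^sup>\<infinity>(G)\<close> is not required: the heat semigroup need not be strongly
  continuous there.) For the heat kernel \<open>p\<close>, bounded \<open>u\<^sub>0\<close> and locally integrable
  \<open>h\<close> this makes all the sums (for almost every \<open>s\<close>) and the time integral below convergent.\<close>

definition mild_solution ::
    "('a \<Rightarrow> real) \<Rightarrow> ('a \<Rightarrow> 'a \<Rightarrow> real \<Rightarrow> real) \<Rightarrow> (real \<Rightarrow> real) \<Rightarrow> real \<Rightarrow> ('a \<Rightarrow> real) \<Rightarrow>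
     real \<Rightarrow> ('a \<Rightarrow> real \<Rightarrow> real) \<Rightarrow> bool" where
  "mild_solution \<mu> p h q u\<^sub>0 \<tau> u \<longleftrightarrow>
     (\<forall>x. \<forall>t\<in>{0<..<\<tau>}. u x t \<ge> 0) \<and>
     (\<forall>x. (\<lambda>t. u x t) \<in> borel_measurable (lebesgue_on {0<..<\<tau>})) \<and>
     (\<exists>M::real. AE t in lebesgue_on {0<..<\<tau>}. linf_norm (\<lambda>x. u x t) \<le> ereal M) \<and>
     (\<forall>x. \<forall>t\<in>{0<..<\<tau>}.
        u x t = (\<Sum>\<^sub>\<infinity>y. p x y t * u\<^sub>0 y * \<mu> y)
              + (LINT s:{0<..<t}|lebesgue. (\<Sum>\<^sub>\<infinity>y. p x y (t - s) * h s * (u y s powr q) * \<mu> y)))"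

text \<open>On \<open>(0,\<tau>\<^sub>m\<^sub>a\<^sub>x)\<close> itself no uniform bound is asked for, only on \<open>(0,\<tau>)\<close> for \<open>\<tau> < \<tau>\<^sub>m\<^sub>a\<^sub>x\<close>.\<close>

definition maximal_mild_solution ::
    "('a \<Rightarrow> real) \<Rightarrow> ('a \<Rightarrow> 'a \<Rightarrow> real \<Rightarrow> real) \<Rightarrow> (real \<Rightarrow> real) \<Rightarrow> real \<Rightarrow> ('a \<Rightarrow> real) \<Rightarrow>
     ereal \<Rightarrow> ('a \<Rightarrow> real \<Rightarrow> real) \<Rightarrow> bool" where
  "maximal_mild_solution \<mu> p h q u\<^sub>0 \<tau>max u \<longleftrightarrow>
     (\<forall>\<tau>. 0 < \<tau> \<and> ereal \<tau> < \<tau>max \<longrightarrow> mild_solution \<mu> p h q u\<^sub>0 \<tau> u) \<and>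
     \<not> (\<exists>\<tau>' v. \<tau>max < ereal \<tau>' \<and> mild_solution \<mu> p h q u\<^sub>0 \<tau>' v \<and>
          (\<forall>x t. 0 < t \<and> ereal t < \<tau>max \<longrightarrow> v x t = u x t))"

end

theory Submission
  imports Defs
begin

text \<open>
  The proof uses the heat semigroup only through the inequality
  \<open>p(x,z,t+s) \<le> \<Sum>\<^sub>y p(x,y,t) p(y,z,s) \<mu>(y)\<close>, which follows from minimality of the kernel: the
  right-hand side continues \<open>p(\<sqdot>,z,\<sqdot>)\<close> beyond time \<open>s\<close> to another positive fundamental solution
  (\<open>kernel_superconvolution\<close>). Consequently, restarting the mild equation at an intermediate time
  can only increase its right-hand side (\<open>nheat_restart\<close>).

  \<^emph>\<open>The maximal time is finite.\<close> Fix a vertex \<open>x\<close> and a time \<open>S\<close>, and let \<open>J(t)\<close> be the contribution to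
  the mild equation at \<open>(x,S)\<close> of the initial datum and of the sources before \<open>t\<close>. The restart inequality
  and Jensen's inequality, for which stochastic completeness provides a probability measure,
  give \<open>J' \<ge> h J\<^sup>q\<close>, hence \<open>H(T) \<le> C J(0)\<^bsup>1-q\<^esup>\<close> for \<open>T < S\<close>, where
  \<open>J(0)\<close> is the free heat flow \<open>e\<^bsup>S\<Delta>\<^esup>u\<^sub>0(x)\<close> (\<open>mild_lower_bound\<close>). For a global solution the growth
  hypothesis on \<open>H\<close> then forces \<open>e\<^bsup>\<Lambda>t\<^esup> p(x,y,t) \<rightarrow> 0\<close> for \<open>\<Lambda> = \<lambda>\<^sub>1 + \<epsilon>\<close>, every \<open>x\<close> and some fixed \<open>y\<close>. But
  the kernel cannot decay that fast: \<open>\<integral>\<^sub>1\<^sup>T e\<^bsup>\<Lambda>t\<^esup> p(x,y,t) dt\<close> would for large \<open>T\<close> be a positive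
  function \<open>\<psi>\<close> with \<open>-\<Delta>\<psi> \<ge> \<Lambda>\<psi>\<close> on any given finite set, and Barta's inequality
  (\<open>energy_ge_of_supersolution\<close>) would yield \<open>\<lambda>\<^sub>1 \<ge> \<Lambda>\<close>.

  \<^emph>\<open>The norm tends to infinity.\<close> Otherwise the norm is at most some \<open>M\<close> at times arbitrarily close
  to \<open>\<tau> = \<tau>\<^sub>m\<^sub>a\<^sub>x\<close>. When the remaining mass of \<open>h\<close> is small, the restart inequality keeps the
  solution below \<open>2M\<close> up to \<open>\<tau>\<close> (\<open>local_bound\<close>). A bounded solution extends beyond \<open>\<tau>\<close> by
  monotone iteration (\<open>bounded_solution_extends\<close>), which contradicts maximality.
\<close>

section \<open>Series, integrals over countable sets and a differential inequality\<close>

text \<open>Termwise differentiation with a summable majorant of the derivatives, transferred to sums over an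
  unordered index set by an enumeration.\<close>

lemma DERIV_infsum:
  fixes f f' :: "'a \<Rightarrow> real \<Rightarrow> real"
  assumes cnt: "countable (UNIV :: 'a set)" "infinite (UNIV :: 'a set)"
    and der: "\<And>y s. a < s \<Longrightarrow> s < b \<Longrightarrow> (f y has_real_derivative f' y s) (at s)"
    and bnd: "\<And>y s. a < s \<Longrightarrow> s < b \<Longrightarrow> \<bar>f' y s\<bar> \<le> M y"
    and M: "M summable_on UNIV"
    and t: "a < t" "t < b" and f: "(\<lambda>y. f y t) summable_on UNIV"
  shows "((\<lambda>s. \<Sum>\<^sub>\<infinity>y. f y s) has_real_derivative (\<Sum>\<^sub>\<infinity>y. f' y t)) (at t)"
proof -
  define e where "e = from_nat_into (UNIV :: 'a set)"
  have e: "bij_betw e UNIV UNIV"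
    unfolding e_def using bij_betw_from_nat_into[OF cnt] .
  have sm: "summable (\<lambda>n. g (e n))" if "g summable_on UNIV" for g :: "'a \<Rightarrow> real"
    using that summable_on_reindex_bij_betw[OF e, of g] summable_on_imp_summable by blast
  have si: "infsum g UNIV = (\<Sum>n. g (e n))" if "g summable_on UNIV" for g :: "'a \<Rightarrow> real"
    using that summable_on_reindex_bij_betw[OF e, of g] infsum_reindex_bij_betw[OF e, of g]
    by (metis has_sum_imp_sums has_sum_infsum sums_unique)
  have f'sum: "(\<lambda>y. f' y s) summable_on UNIV" if "a < s" "s < b" for s
    by (rule abs_summable_summable, rule summable_on_comparison_test[OF M]) (use bnd[OF that] in auto)
  have uc: "uniformly_convergent_on {a<..<b} (\<lambda>n s. \<Sum>i<n. f' (e i) s)"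
    by (rule Weierstrass_m_test'[where M = "\<lambda>n. M (e n)"]) (use bnd sm[OF M] in auto)
  note D = has_field_derivative_series'[of "{a<..<b}" "\<lambda>n. f (e n)" "\<lambda>n. f' (e n)" t]
  have D1: "summable (\<lambda>n. f (e n) s)" if "a < s" "s < b" for s
    by (rule D(1)) (use that t uc sm[OF f] in \<open>auto intro!: has_field_derivative_at_within[OF der] simp: interior_open\<close>)
  have fsum: "(\<lambda>y. f y s) summable_on UNIV" if s: "a < s" "s < b" for s
  proof -
    have "\<bar>f y s - f y t\<bar> \<le> M y * \<bar>s - t\<bar>" for y
    proof -
      have "norm (f y s - f y t) \<le> M y * norm (s - t)"
        by (rule field_differentiable_bound[of "{a<..<b}" "f y" "f' y"])
           (use s t bnd in \<open>auto intro!: has_field_derivative_at_within[OF der]\<close>)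
      then show ?thesis by simp
    qed
    then have "(\<lambda>y. f y s - f y t) summable_on UNIV"
      by (intro abs_summable_summable[OF summable_on_comparison_test[OF summable_on_cmult_left[OF M, of "\<bar>s - t\<bar>"]]]) auto
    from summable_on_add[OF this f] show ?thesis by simp
  qed
  have "((\<lambda>s. \<Sum>n. f (e n) s) has_real_derivative (\<Sum>n. f' (e n) t)) (at t)"
    by (rule D(2)) (use t uc sm[OF f] in \<open>auto intro!: has_field_derivative_at_within[OF der] simp: interior_open\<close>)
  then have "((\<lambda>s. \<Sum>n. f (e n) s) has_real_derivative (\<Sum>\<^sub>\<infinity>y. f' y t)) (at t)"
    by (simp add: si f'sum t)
  then show ?thesis
    by (rule has_field_derivative_transform_within_open[of _ _ _ "{a<..<b}"])
       (use t fsum si in auto)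
qed

text \<open>A consequence of l'Hospital's rule. It turns a continuous function glued from two smooth
  pieces into a differentiable one as soon as the one-sided derivatives match.\<close>

lemma DERIV_from_limit:
  fixes F D :: "real \<Rightarrow> real"
  assumes "isCont F s" "isCont D s"
    and "eventually (\<lambda>t. (F has_real_derivative D t) (at t)) (at s)"
  shows "(F has_real_derivative D s) (at s)"
proof -
  have "((\<lambda>t. (F t - F s) / (t - s)) \<longlongrightarrow> D s) (at s)"
  proof (rule lhopital[where g' = "\<lambda>_. 1" and f' = D])
    show "((\<lambda>t. F t - F s) \<longlongrightarrow> 0) (at s)"
      using assms(1) by (simp add: isCont_def LIM_zero_iff)
    show "((\<lambda>t. D t / 1) \<longlongrightarrow> D s) (at s)"
      using assms(2) by (simp add: isCont_def)
    show "\<forall>\<^sub>F t in at s. ((\<lambda>t. F t - F s) has_real_derivative D t) (at t)"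
      using assms(3) by eventually_elim (auto intro!: derivative_eq_intros)
    show "((\<lambda>t. t - s) \<longlongrightarrow> 0) (at s)" by (simp add: LIM_zero_iff)
    show "\<forall>\<^sub>F t in at s. t - s \<noteq> 0" by (simp add: eventually_at_filter)
    show "\<forall>\<^sub>F t in at s. ((\<lambda>t. t - s) has_real_derivative 1) (at t)"
      by (intro always_eventually) (auto intro!: derivative_eq_intros)
  qed auto
  then show ?thesis by (simp add: has_field_derivative_iff)
qed

lemma has_sum_sum_finite:
  fixes g :: "'b \<Rightarrow> 'a \<Rightarrow> real"
  assumes "finite Z" "\<And>z. z \<in> Z \<Longrightarrow> (g z has_sum S z) A"
  shows "((\<lambda>y. \<Sum>z\<in>Z. g z y) has_sum (\<Sum>z\<in>Z. S z)) A"
  using assms by (induction rule: finite_induct) (auto intro!: has_sum_add)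

lemma summable_on_sum_finite:
  fixes g :: "'b \<Rightarrow> 'a \<Rightarrow> real"
  assumes "finite Z" "\<And>z. z \<in> Z \<Longrightarrow> g z summable_on A"
  shows "(\<lambda>y. \<Sum>z\<in>Z. g z y) summable_on A"
  using has_sum_sum_finite[OF assms(1), of g A "\<lambda>z. infsum (g z) A"] assms(2) has_sum_infsum summable_on_def by blast

lemma nn_integral_count_space_infsum:
  assumes "\<And>x. f x \<ge> 0" "f summable_on A"
  shows "(\<integral>\<^sup>+x. ennreal (f x) \<partial>count_space A) = ennreal (infsum f A)"
proof -
  have "Infinite_Set_Sum.abs_summable_on f A" using assms
    using abs_summable_equivalent by fastforce
  then show ?thesis using assms
    by (simp add: nn_integral_conv_infsetsum infsetsum_infsum)
qed

lemma summable_on_if_nn_integral_finite: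
  assumes "\<And>x. f x \<ge> 0" "(\<integral>\<^sup>+x. ennreal (f x) \<partial>count_space A) < \<infinity>"
  shows "f summable_on A"
proof -
  have "Infinite_Set_Sum.abs_summable_on f A"
    unfolding abs_summable_on_def
    by (rule integrableI_nonneg) (use assms in auto)
  then show ?thesis 
    using abs_summable_equivalent abs_summable_summable by blast
qed

text \<open>Both sides are 0 when the series diverges: by convention \<open>infsum\<close> is then 0, and so is
  \<open>enn2real \<infinity>\<close>.\<close>

lemma infsum_eq_enn2real_nn_integral:
  fixes f :: "'a \<Rightarrow> real"
  assumes "\<And>x. f x \<ge> 0"
  shows "infsum f A = enn2real (\<integral>\<^sup>+x. ennreal (f x) \<partial>count_space A)"
proof (cases "f summable_on A")
  case True
  then show ?thesis using assms by (simp add: nn_integral_count_space_infsum infsum_nonneg)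
next
  case False
  then have "(\<integral>\<^sup>+x. ennreal (f x) \<partial>count_space A) = \<infinity>"
    using summable_on_if_nn_integral_finite[of f A] assms less_top by force
  then show ?thesis using False by (simp add: infsum_not_exists)
qed

lemma borel_measurable_nn_integral_count_space:
  fixes f :: "'a \<Rightarrow> 'b \<Rightarrow> ennreal"
  assumes "countable (UNIV :: 'a set)" and f: "\<And>y. f y \<in> borel_measurable M"
  shows "(\<lambda>s. \<integral>\<^sup>+y. f y s \<partial>count_space UNIV) \<in> borel_measurable M"
proof -
  interpret sigma_finite_measure "count_space (UNIV :: 'a set)"
    by (rule sigma_finite_measure_count_space_countable[OF assms(1)])
  have "(\<lambda>(y, s). f y s) \<in> borel_measurable (count_space UNIV \<Otimes>\<^sub>M M)"
    by (rule measurable_pair_measure_countable1) (use assms in auto)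
  then have "(\<lambda>(s, y). f y s) \<in> borel_measurable (M \<Otimes>\<^sub>M count_space UNIV)"
    using measurable_pair_swap_iff[of "\<lambda>(y, s). f y s" "count_space UNIV" M borel] by (simp add: split_def)
  then show ?thesis
    by (rule borel_measurable_nn_integral)
qed

lemma continuous_on_increment_small:
  fixes f :: "real \<Rightarrow> real"
  assumes "continuous_on {A..T} f" "A \<le> x" "x \<le> T" "e > 0"
  obtains d where "d > 0"
    "\<And>a b. A \<le> a \<Longrightarrow> a \<le> x \<Longrightarrow> x \<le> b \<Longrightarrow> b \<le> T \<Longrightarrow> b - a < d \<Longrightarrow> f b - f a < e"
proof -
  obtain d where d: "d > 0" "\<And>y. y \<in> {A..T} \<Longrightarrow> dist y x < d \<Longrightarrow> dist (f y) (f x) < e / 2"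
    using assms unfolding continuous_on_iff by (metis atLeastAtMost_iff half_gt_zero)
  have "f b - f a < e" if "A \<le> a" "a \<le> x" "x \<le> b" "b \<le> T" "b - a < d" for a b
  proof -
    have "dist (f a) (f x) < e / 2" "dist (f b) (f x) < e / 2"
      by (rule d; use that in \<open>auto simp: dist_real_def\<close>)+
    then show ?thesis unfolding dist_real_def by linarith
  qed
  then show ?thesis using that d(1) by blast
qed

text \<open>Formally \<open>J' \<ge> h J\<^sup>q\<close> integrates to \<open>(q - 1) H \<le> J(0)\<^bsup>1-q\<^esup>\<close>. Here \<open>J\<close> need not be
  differentiable, so the increments of the primitive \<open>\<phi>(x) = x\<^bsup>1-q\<^esup> / (q - 1)\<close> along \<open>J\<close> are
  compared with those of \<open>H\<close> on short intervals, where \<open>J\<close> varies so little that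
  \<open>J(a)\<^sup>q \<ge> J(b)\<^sup>q / 2\<close>; this costs the factor 2 in the bound. Bolzano's lemma assembles
  the short intervals.\<close>

lemma blowup_inequality:
  fixes J H :: "real \<Rightarrow> real"
  assumes T: "0 \<le> T" and q: "q > 1" and H: "continuous_on {0..T} H" and J0: "J 0 > 0" and C: "C \<ge> 0"
    and mono: "\<And>a b. 0 \<le> a \<Longrightarrow> a \<le> b \<Longrightarrow> b \<le> T \<Longrightarrow> H a \<le> H b"
    and lower: "\<And>a b. 0 \<le> a \<Longrightarrow> a \<le> b \<Longrightarrow> b \<le> T \<Longrightarrow> J a powr q * (H b - H a) \<le> J b - J a"
    and upper: "\<And>a b. 0 \<le> a \<Longrightarrow> a \<le> b \<Longrightarrow> b \<le> T \<Longrightarrow> J b - J a \<le> C * (H b - H a)"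
  shows "H T - H 0 \<le> 2 / (q - 1) * J 0 powr (1 - q)"
proof -
  define \<phi> where "\<phi> x = x powr (1 - q) / (q - 1)" for x :: real
  have \<phi>: "B powr (- q) * (B - A) \<le> \<phi> A - \<phi> B" if "0 < A" "A \<le> B" for A B
  proof (cases "A = B")
    case False
    have "((\<lambda>x. - \<phi> x) has_real_derivative x powr (- q)) (at x)" if "A \<le> x" for x
    proof -
      have "(\<phi> has_real_derivative (1 - q) * x powr (1 - q - 1) / (q - 1)) (at x)"
        unfolding \<phi>_def using that \<open>0 < A\<close>
        by (intro DERIV_cdivide has_real_derivative_powr) auto
      moreover have "(1 - q) * x powr (1 - q - 1) / (q - 1) = - (x powr (- q))"
        using q by (simp add: field_simps)
      ultimately show ?thesis by (auto dest: DERIV_minus)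
    qed
    from MVT2[of A B "\<lambda>x. - \<phi> x", OF _ this] that False
    obtain z where z: "A < z" "z < B" "\<phi> A - \<phi> B = (B - A) * z powr (- q)" by auto
    have "B powr (- q) \<le> z powr (- q)"
      using z that q by (intro powr_mono2') auto
    then show ?thesis using z that by (simp add: mult.commute mult_left_mono)
  qed simp
  have Jmono: "J a \<le> J b" if "0 \<le> a" "a \<le> b" "b \<le> T" for a b
    using lower[OF that] mono[OF that] by (smt (verit) mult_nonneg_nonneg powr_ge_zero)
  define Q where "Q a b \<longleftrightarrow> (0 \<le> a \<and> b \<le> T \<longrightarrow> 1 / 2 * (H b - H a) \<le> \<phi> (J a) - \<phi> (J b))" for a b
  have "Q 0 T"
    using T
  proof (induction rule: Bolzano)
    case (trans a b c)
    then show ?case unfolding Q_def by auto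
  next
    case (local x)
    have c: "1 < 2 powr (1 / q)" using q by (simp add: gr_one_powr)
    \<comment> \<open>an increment \<open>e\<close> of \<open>H\<close> lets \<open>J\<close> grow at most by the factor \<open>2\<^bsup>1/q\<^esup>\<close>\<close>
    define e where "e = (2 powr (1 / q) - 1) * J 0 / (C + 1)"
    have e: "e > 0" unfolding e_def using c J0 C by simp
    obtain d where d: "d > 0"
      "\<And>a b. 0 \<le> a \<Longrightarrow> a \<le> x \<Longrightarrow> x \<le> b \<Longrightarrow> b \<le> T \<Longrightarrow> b - a < d \<Longrightarrow> H b - H a < e"
      using continuous_on_increment_small[OF H local e] by blast
    show ?case unfolding Q_def
    proof (intro exI[of _ d] conjI allI impI d(1))
      fix a b assume ab: "a \<le> x \<and> x \<le> b \<and> b - a < d" "0 \<le> a \<and> b \<le> T"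
      have He: "H b - H a \<le> e" using d(2)[of a b] ab by simp
      have pos: "J a \<ge> J 0" "J b \<ge> J a" using ab by (auto intro!: Jmono)
      have "J b - J a \<le> C * (H b - H a)" using ab by (intro upper) auto
      also have "\<dots> \<le> C * e" using He C by (rule mult_left_mono)
      also have "\<dots> \<le> (C + 1) * e" using e by (simp add: distrib_right)
      also have "\<dots> = (2 powr (1 / q) - 1) * J 0" using C by (simp add: e_def)
      also have "\<dots> \<le> (2 powr (1 / q) - 1) * J a" using c pos by (intro mult_left_mono) auto
      finally have "J b \<le> 2 powr (1 / q) * J a" by (simp add: left_diff_distrib)
      then have "J b powr q \<le> (2 powr (1 / q) * J a) powr q"
        using pos J0 q by (intro powr_mono2) auto
      also have "\<dots> = 2 * J a powr q"
        using pos J0 q by (simp add: powr_mult powr_powr)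
      finally have "1 / 2 \<le> J b powr (- q) * J a powr q"
        using pos J0 by (simp add: powr_minus field_simps)
      then have "1 / 2 * (H b - H a) \<le> J b powr (- q) * J a powr q * (H b - H a)"
        using mono[of a b] ab by (intro mult_right_mono) auto
      also have "\<dots> = J b powr (- q) * (J a powr q * (H b - H a))" by simp
      also have "\<dots> \<le> J b powr (- q) * (J b - J a)"
        using ab by (intro mult_left_mono lower) auto
      also have "\<dots> \<le> \<phi> (J a) - \<phi> (J b)" using pos J0 by (intro \<phi>) auto
      finally show "1 / 2 * (H b - H a) \<le> \<phi> (J a) - \<phi> (J b)" .
    qed
  qed
  moreover have "\<phi> (J T) \<ge> 0" unfolding \<phi>_def using q by simp
  ultimately have "H T - H 0 \<le> 2 * \<phi> (J 0)" by (simp add: Q_def)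
  then show ?thesis by (simp add: \<phi>_def)
qed

section \<open>The Laplacian and the bottom of the spectrum\<close>

context weighted_graph
begin

definition nbrs :: "'a \<Rightarrow> 'a set" where
  "nbrs x = {y. \<omega> x y > 0}"

definition deg :: "'a \<Rightarrow> real" where
  "deg x = (\<Sum>y\<in>nbrs x. \<omega> x y) / \<mu> x"

lemma finite_nbrs: "finite (nbrs x)"
  unfolding nbrs_def by (rule locally_finite)

lemma weight_eq_0: "y \<notin> nbrs x \<Longrightarrow> \<omega> x y = 0"
  using weight_nonneg[of x y] by (auto simp: nbrs_def)

lemma deg_nonneg: "deg x \<ge> 0"
  unfolding deg_def using measure_pos[of x]
  by (intro divide_nonneg_pos sum_nonneg) (auto simp: weight_nonneg)

text \<open>By local finiteness the Laplacian is a finite sum, so it commutes with limits, with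
  summation over \<open>y\<close> and with time integrals.\<close>

lemma laplacian_eq:
  "laplacian \<omega> \<mu> f x = (\<Sum>y\<in>nbrs x. \<omega> x y / \<mu> x * f y) - deg x * f x"
proof -
  have "(\<Sum>\<^sub>\<infinity>y. (f y - f x) * \<omega> x y) = (\<Sum>\<^sub>\<infinity>y\<in>nbrs x. (f y - f x) * \<omega> x y)"
    by (rule infsum_cong_neutral) (auto simp: weight_eq_0)
  also have "\<dots> = (\<Sum>y\<in>nbrs x. (f y - f x) * \<omega> x y)"
    by (simp add: finite_nbrs)
  finally show ?thesis
    by (simp add: laplacian_def deg_def left_diff_distrib sum_subtractf diff_divide_distrib
        right_diff_distrib sum_divide_distrib sum_distrib_left sum_distrib_right mult.commute)
qed

lemma nbrs_sym: "y \<in> nbrs x \<longleftrightarrow> x \<in> nbrs y"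
  unfolding nbrs_def using weight_sym[of x y] by simp

text \<open>Writing \<open>f = \<psi> g\<close>, the edge term \<open>(f(y) - f(x))\<^sup>2\<close> equals
  \<open>f(x)\<^sup>2 (1 - \<psi>(y)/\<psi>(x)) + f(y)\<^sup>2 (1 - \<psi>(x)/\<psi>(y)) + \<psi>(x) \<psi>(y) (g(y) - g(x))\<^sup>2\<close>. Dropping the last
  square and summing over the edges leaves \<open>- \<Delta>\<psi>/\<psi>\<close> weighted by \<open>f\<^sup>2 \<mu>\<close>. This is Barta's
  inequality; asking for the supersolution property on the support of \<open>f\<close> alone permits a
  \<open>\<psi>\<close> that depends on this support.\<close>

lemma energy_ge_of_supersolution:
  assumes fin: "finite {x. f x \<noteq> 0}" and \<psi>: "\<And>x. \<psi> x > 0"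
    and super: "\<And>x. f x \<noteq> 0 \<Longrightarrow> laplacian \<omega> \<mu> \<psi> x \<le> - \<Lambda> * \<psi> x"
  shows "\<Lambda> * (\<Sum>\<^sub>\<infinity>x. (f x)\<^sup>2 * \<mu> x) \<le> 1 / 2 * (\<Sum>\<^sub>\<infinity>(x, y)\<in>UNIV. \<omega> x y * (f y - f x)\<^sup>2)"
proof -
  define S where "S = {x. f x \<noteq> 0}"
  define V where "V = S \<union> (\<Union>x\<in>S. nbrs x)"
  have finS: "finite S" using fin by (simp add: S_def)
  have finV: "finite V" unfolding V_def using finS finite_nbrs by auto
  have f0: "f x = 0" if "x \<notin> S" for x using that by (simp add: S_def)
  have zero: "\<omega> x y * (f y - f x)\<^sup>2 = 0" if "x \<notin> V \<or> y \<notin> V" for x y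
    using that f0[of x] f0[of y] nbrs_sym[of x y] weight_eq_0[of y x]
    by (cases "x \<in> S \<or> y \<in> S") (auto simp: V_def)
  have "(\<Sum>\<^sub>\<infinity>(x, y)\<in>UNIV. \<omega> x y * (f y - f x)\<^sup>2) = (\<Sum>\<^sub>\<infinity>(x, y)\<in>V \<times> V. \<omega> x y * (f y - f x)\<^sup>2)"
  proof (rule infsum_cong_neutral)
    fix z assume "z \<in> UNIV - V \<times> V"
    then show "(case z of (x, y) \<Rightarrow> \<omega> x y * (f y - f x)\<^sup>2) = 0"
      using zero[of "fst z" "snd z"] by (cases z) auto
  qed auto
  also have "\<dots> = (\<Sum>(x, y)\<in>V \<times> V. \<omega> x y * (f y - f x)\<^sup>2)"
    using finV by (intro infsum_finite) simp
  also have "\<dots> = (\<Sum>x\<in>V. \<Sum>y\<in>V. \<omega> x y * (f y - f x)\<^sup>2)"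
    by (rule sum.cartesian_product[symmetric])
  finally have energy: "(\<Sum>\<^sub>\<infinity>(x, y)\<in>UNIV. \<omega> x y * (f y - f x)\<^sup>2) = (\<Sum>x\<in>V. \<Sum>y\<in>V. \<omega> x y * (f y - f x)\<^sup>2)" .
  have pointwise: "(f x)\<^sup>2 * (1 - \<psi> y / \<psi> x) + (f y)\<^sup>2 * (1 - \<psi> x / \<psi> y) \<le> (f y - f x)\<^sup>2" for x y
  proof -
    have "(f y - f x)\<^sup>2 - ((f x)\<^sup>2 * (1 - \<psi> y / \<psi> x) + (f y)\<^sup>2 * (1 - \<psi> x / \<psi> y))
        = (f x * \<psi> y - f y * \<psi> x)\<^sup>2 / (\<psi> x * \<psi> y)"
      using \<psi>[of x] \<psi>[of y] by (simp add: field_simps power2_eq_square)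
    moreover have "(f x * \<psi> y - f y * \<psi> x)\<^sup>2 / (\<psi> x * \<psi> y) \<ge> 0"
      using \<psi>[of x] \<psi>[of y] by (intro divide_nonneg_pos) auto
    ultimately show ?thesis by simp
  qed
  define A where "A x y = \<omega> x y * ((f x)\<^sup>2 * (1 - \<psi> y / \<psi> x))" for x y
  have "(\<Sum>x\<in>V. \<Sum>y\<in>V. A y x) = (\<Sum>x\<in>V. \<Sum>y\<in>V. A x y)"
    by (rule sum.swap)
  then have "2 * (\<Sum>x\<in>V. \<Sum>y\<in>V. A x y) = (\<Sum>x\<in>V. \<Sum>y\<in>V. A x y + A y x)"
    by (simp add: sum.distrib)
  also have "\<dots> \<le> (\<Sum>x\<in>V. \<Sum>y\<in>V. \<omega> x y * (f y - f x)\<^sup>2)"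
  proof (intro sum_mono)
    fix x y
    have "A x y + A y x = \<omega> x y * ((f x)\<^sup>2 * (1 - \<psi> y / \<psi> x) + (f y)\<^sup>2 * (1 - \<psi> x / \<psi> y))"
      by (simp add: A_def weight_sym[of y x] distrib_left)
    then show "A x y + A y x \<le> \<omega> x y * (f y - f x)\<^sup>2"
      by (simp add: mult_left_mono[OF pointwise weight_nonneg])
  qed
  finally have 1: "2 * (\<Sum>x\<in>V. \<Sum>y\<in>V. A x y) \<le> (\<Sum>\<^sub>\<infinity>(x, y)\<in>UNIV. \<omega> x y * (f y - f x)\<^sup>2)"
    by (simp add: energy)
  have le: "\<Lambda> * ((f x)\<^sup>2 * \<mu> x) \<le> (\<Sum>y\<in>V. A x y)" for x
  proof (cases "x \<in> S")
    case True
    have "(\<Sum>y\<in>V. A x y) = (\<Sum>y\<in>nbrs x. A x y)"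
      using True finV by (intro sum.mono_neutral_right) (auto simp: V_def A_def weight_eq_0)
    also have "\<dots> = (f x)\<^sup>2 * \<mu> x / \<psi> x * (\<Sum>y\<in>nbrs x. \<omega> x y / \<mu> x * \<psi> x - \<omega> x y / \<mu> x * \<psi> y)"
      unfolding sum_distrib_left using \<psi>[of x] measure_pos[of x]
      by (intro sum.cong) (auto simp: A_def field_simps)
    also have "\<dots> = (f x)\<^sup>2 * \<mu> x / \<psi> x * (- laplacian \<omega> \<mu> \<psi> x)"
      by (simp add: laplacian_eq deg_def sum_subtractf sum_distrib_right sum_divide_distrib)
    finally have eq: "(\<Sum>y\<in>V. A x y) = (f x)\<^sup>2 * \<mu> x / \<psi> x * (- laplacian \<omega> \<mu> \<psi> x)" .
    have "(f x)\<^sup>2 * \<mu> x / \<psi> x * (\<Lambda> * \<psi> x) \<le> (f x)\<^sup>2 * \<mu> x / \<psi> x * (- laplacian \<omega> \<mu> \<psi> x)"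
      using super[of x] True \<psi>[of x] measure_pos[of x]
      by (intro mult_left_mono) (auto simp: S_def)
    then show ?thesis unfolding eq using \<psi>[of x] by (simp add: field_simps)
  qed (auto simp: f0 A_def)
  then have "(\<Sum>x\<in>V. \<Lambda> * ((f x)\<^sup>2 * \<mu> x)) \<le> (\<Sum>x\<in>V. \<Sum>y\<in>V. A x y)"
    by (intro sum_mono)
  moreover have "(\<Sum>\<^sub>\<infinity>x. (f x)\<^sup>2 * \<mu> x) = (\<Sum>x\<in>V. (f x)\<^sup>2 * \<mu> x)"
  proof -
    have "(\<Sum>\<^sub>\<infinity>x. (f x)\<^sup>2 * \<mu> x) = (\<Sum>\<^sub>\<infinity>x\<in>V. (f x)\<^sup>2 * \<mu> x)"
      by (rule infsum_cong_neutral) (auto simp: V_def f0)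
    then show ?thesis using finV by simp
  qed
  ultimately have "\<Lambda> * (\<Sum>\<^sub>\<infinity>x. (f x)\<^sup>2 * \<mu> x) \<le> (\<Sum>x\<in>V. \<Sum>y\<in>V. A x y)"
    by (simp only: sum_distrib_left)
  also have "\<dots> \<le> 1 / 2 * (\<Sum>\<^sub>\<infinity>(x, y)\<in>UNIV. \<omega> x y * (f y - f x)\<^sup>2)"
    using 1 by linarith
  finally show ?thesis .
qed

lemma bottom_spectrum_ge:
  assumes "\<And>f :: 'a \<Rightarrow> real. finite {x. f x \<noteq> 0} \<Longrightarrow> \<exists>\<psi>. (\<forall>x. \<psi> x > 0) \<and>
      (\<forall>x. f x \<noteq> 0 \<longrightarrow> laplacian \<omega> \<mu> \<psi> x \<le> - \<Lambda> * \<psi> x)"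
  shows "\<Lambda> \<le> bottom_spectrum \<omega> \<mu>"
  unfolding bottom_spectrum_def
proof (rule cINF_greatest)
  have "(\<lambda>x. if x = undefined then 1 else 0) \<in> {f::'a \<Rightarrow> real. finite {x. f x \<noteq> 0} \<and> (\<exists>x. f x \<noteq> 0)}"
    by simp
  then show "{f::'a \<Rightarrow> real. finite {x. f x \<noteq> 0} \<and> (\<exists>x. f x \<noteq> 0)} \<noteq> {}"
    by (metis empty_iff)
next
  fix f :: "'a \<Rightarrow> real" assume f: "f \<in> {f. finite {x. f x \<noteq> 0} \<and> (\<exists>x. f x \<noteq> 0)}"
  obtain \<psi> where \<psi>: "\<And>x. \<psi> x > 0" "\<And>x. f x \<noteq> 0 \<Longrightarrow> laplacian \<omega> \<mu> \<psi> x \<le> - \<Lambda> * \<psi> x"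
    using assms[of f] f by auto
  have "(\<Sum>\<^sub>\<infinity>x. (f x)\<^sup>2 * \<mu> x) = (\<Sum>\<^sub>\<infinity>x\<in>{x. f x \<noteq> 0}. (f x)\<^sup>2 * \<mu> x)"
    by (rule infsum_cong_neutral) auto
  also have "\<dots> = (\<Sum>x\<in>{x. f x \<noteq> 0}. (f x)\<^sup>2 * \<mu> x)" using f by simp
  also have "\<dots> > 0" using f measure_pos by (intro sum_pos) auto
  finally show "\<Lambda> \<le> 1 / 2 * (\<Sum>\<^sub>\<infinity>(x, y)\<in>UNIV. \<omega> x y * (f y - f x)\<^sup>2) / (\<Sum>\<^sub>\<infinity>x. (f x)\<^sup>2 * \<mu> x)"
    using energy_ge_of_supersolution[of f \<psi> \<Lambda>] f \<psi> by (simp add: pos_le_divide_eq)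
qed

end

section \<open>Minimal heat kernels on stochastically complete graphs\<close>

locale complete_heat_graph = weighted_graph +
  fixes p :: "'a \<Rightarrow> 'a \<Rightarrow> real \<Rightarrow> real"
  assumes heat_kernel: "heat_kernel \<omega> \<mu> p"
    and complete: "stochastically_complete \<mu> p"
begin

lemma kernel_pos: "t > 0 \<Longrightarrow> p x y t > 0"
  using heat_kernel by (simp add: heat_kernel_def positive_fundamental_solution_def)

lemma kernel_nonneg: "t > 0 \<Longrightarrow> p x y t \<ge> 0"
  using kernel_pos by (simp add: less_imp_le)

lemma kernel_DERIV:
  "t > 0 \<Longrightarrow> ((\<lambda>s. p x y s) has_real_derivative laplacian \<omega> \<mu> (\<lambda>z. p z y t) x) (at t)"
  using heat_kernel by (simp add: heat_kernel_def positive_fundamental_solution_def)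

lemma kernel_initial:
  "((\<lambda>t. p x y t) \<longlongrightarrow> (if x = y then 1 / \<mu> x else 0)) (at_right 0)"
  using heat_kernel unfolding heat_kernel_def positive_fundamental_solution_def by blast

lemma kernel_minimal:
  "positive_fundamental_solution \<omega> \<mu> p' \<Longrightarrow> t > 0 \<Longrightarrow> p x y t \<le> p' x y t"
  using heat_kernel by (simp add: heat_kernel_def)

lemma kernel_mass: "t > 0 \<Longrightarrow> ((\<lambda>y. p x y t * \<mu> y) has_sum 1) UNIV"
  using complete by (simp add: stochastically_complete_def)

lemma kernel_summable: "t > 0 \<Longrightarrow> (\<lambda>y. p x y t * \<mu> y) summable_on UNIV"
  using kernel_mass summable_on_def by blast

lemma kernel_measure_le_1:
  assumes "t > 0" shows "p x y t * \<mu> y \<le> 1"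
proof -
  have "(\<Sum>y\<in>{y}. p x y t * \<mu> y) \<le> 1"
    by (rule finite_sum_le_has_sum[OF kernel_mass])
       (use assms measure_pos kernel_pos in \<open>auto simp: less_imp_le\<close>)
  then show ?thesis by simp
qed

text \<open>The integrating factor removes the only negative term of the heat equation at \<open>x\<close>.\<close>

lemma kernel_exp_mono:
  assumes "0 < s" "s \<le> t"
  shows "exp (deg x * s) * p x y s \<le> exp (deg x * t) * p x y t"
proof (rule DERIV_nonneg_imp_nondecreasing[OF assms(2)])
  fix r assume r: "s \<le> r" "r \<le> t"
  have "((\<lambda>r. exp (deg x * r) * p x y r) has_real_derivative
      exp (deg x * r) * (\<Sum>z\<in>nbrs x. \<omega> x z / \<mu> x * p z y r)) (at r)"
    using assms r
    by (auto intro!: derivative_eq_intros kernel_DERIV simp: laplacian_eq algebra_simps)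
  moreover have "0 \<le> exp (deg x * r) * (\<Sum>z\<in>nbrs x. \<omega> x z / \<mu> x * p z y r)"
    using assms r measure_pos[of x]
    by (intro mult_nonneg_nonneg sum_nonneg divide_nonneg_pos) (auto simp: weight_nonneg kernel_nonneg)
  ultimately show "\<exists>D. ((\<lambda>r. exp (deg x * r) * p x y r) has_real_derivative D) (at r) \<and> 0 \<le> D"
    by blast
qed

text \<open>The kernel at time \<open>t\<close> dominates, up to a factor that does not depend on \<open>y\<close>, the kernel at
  all earlier times. As it is summable in \<open>y\<close>, this is the majorant with which the heat
  flow is differentiated term by term and its initial value computed.\<close>

lemma kernel_bound:
  assumes "0 < s" "s \<le> t"
  shows "p x y s \<le> exp (deg x * t) * p x y t"
proof -
  have "1 * p x y s \<le> exp (deg x * s) * p x y s"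
    using assms deg_nonneg[of x] by (intro mult_right_mono kernel_nonneg) auto
  also note kernel_exp_mono[OF assms]
  finally show ?thesis by simp
qed

lemma kernel_bound_abs:
  assumes "0 < s" "s \<le> t" and c: "\<bar>c\<bar> \<le> B"
  shows "\<bar>p x y s * \<mu> y * c\<bar> \<le> exp (deg x * t) * p x y t * \<mu> y * B"
proof -
  have "\<bar>p x y s * \<mu> y * c\<bar> = p x y s * \<mu> y * \<bar>c\<bar>"
    using assms kernel_nonneg[of s x y] measure_pos[of y] by (simp add: abs_mult)
  also have "\<dots> \<le> (exp (deg x * t) * p x y t) * \<mu> y * B"
    using assms kernel_nonneg[of s x y] kernel_nonneg[of t x y] measure_pos[of y]
    by (intro mult_mono kernel_bound) auto
  finally show ?thesis .
qed

definition heat :: "real \<Rightarrow> ('a \<Rightarrow> real) \<Rightarrow> 'a \<Rightarrow> real" where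
  "heat t f x = (\<Sum>\<^sub>\<infinity>y. p x y t * \<mu> y * f y)"

lemma heat_summable:
  assumes f: "\<And>y. \<bar>f y\<bar> \<le> B" and "t > 0"
  shows "(\<lambda>y. p x y t * \<mu> y * f y) summable_on UNIV"
proof (rule abs_summable_summable, rule summable_on_comparison_test)
  show "(\<lambda>y. p x y t * \<mu> y * B) summable_on UNIV"
    by (intro summable_on_cmult_left kernel_summable assms)
  show "norm (p x y t * \<mu> y * f y) \<le> p x y t * \<mu> y * B" for y
    using assms kernel_nonneg[of t x y] measure_pos[of y]
    by (auto simp: abs_mult intro!: mult_left_mono)
qed auto

lemma kernel_bound_summable:
  assumes "b > 0"
  shows "(\<lambda>y. exp (deg z * b) * p z y b * \<mu> y * B) summable_on UNIV"
proof -
  have "(\<lambda>y. exp (deg z * b) * (p z y b * \<mu> y) * B) summable_on UNIV"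
    by (intro summable_on_cmult_left summable_on_cmult_right kernel_summable assms)
  then show ?thesis by (simp add: mult.assoc)
qed

lemma heat_DERIV:
  assumes f: "\<And>y. \<bar>f y\<bar> \<le> B" and t: "t > 0"
  shows "((\<lambda>s. heat s f x) has_real_derivative laplacian \<omega> \<mu> (heat t f) x) (at t)"
proof -
  define b where "b = t + 1"
  define M where "M y = (\<Sum>z\<in>nbrs x. \<omega> x z / \<mu> x * (exp (deg z * b) * p z y b * \<mu> y * B))
      + deg x * (exp (deg x * b) * p x y b * \<mu> y * B)" for y
  have le: "\<bar>p z y s * \<mu> y * f y\<bar> \<le> exp (deg z * b) * p z y b * \<mu> y * B" if "0 < s" "s < b" for y z s
    using that f by (intro kernel_bound_abs) auto
  have "((\<lambda>s. \<Sum>\<^sub>\<infinity>y. p x y s * \<mu> y * f y) has_real_derivative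
      (\<Sum>\<^sub>\<infinity>y. laplacian \<omega> \<mu> (\<lambda>z. p z y t) x * \<mu> y * f y)) (at t)"
  proof (rule DERIV_infsum[where a = 0 and b = b and M = M])
    show "((\<lambda>s. p x y s * \<mu> y * f y) has_real_derivative
        laplacian \<omega> \<mu> (\<lambda>z. p z y s) x * \<mu> y * f y) (at s)" if "0 < s" for s y
      using that by (auto intro!: derivative_eq_intros kernel_DERIV)
    show "\<bar>laplacian \<omega> \<mu> (\<lambda>z. p z y s) x * \<mu> y * f y\<bar> \<le> M y" if s: "0 < s" "s < b" for s y
    proof -
      have "laplacian \<omega> \<mu> (\<lambda>z. p z y s) x * \<mu> y * f y =
          (\<Sum>z\<in>nbrs x. \<omega> x z / \<mu> x * (p z y s * \<mu> y * f y)) - deg x * (p x y s * \<mu> y * f y)"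
        by (simp add: laplacian_eq left_diff_distrib sum_distrib_right mult.assoc)
      also have "\<bar>\<dots>\<bar> \<le> (\<Sum>z\<in>nbrs x. \<bar>\<omega> x z / \<mu> x * (p z y s * \<mu> y * f y)\<bar>) + \<bar>deg x * (p x y s * \<mu> y * f y)\<bar>"
        by (intro order_trans[OF abs_triangle_ineq4] add_right_mono sum_abs)
      also have "\<dots> \<le> M y"
      proof -
        have c: "\<bar>c * (p z y s * \<mu> y * f y)\<bar> \<le> c * (exp (deg z * b) * p z y b * \<mu> y * B)" if "c \<ge> 0" for c z
          using mult_left_mono[OF le[OF s, of z y] that] that by (simp add: abs_mult)
        then show ?thesis
          unfolding M_def using measure_pos[of x]
          by (intro add_mono sum_mono c) (auto simp: weight_nonneg deg_nonneg less_imp_le)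
      qed
      finally show ?thesis .
    qed
    show "M summable_on UNIV"
      unfolding M_def using t
      by (intro summable_on_add summable_on_cmult_right summable_on_sum_finite finite_nbrs kernel_bound_summable)
         (auto simp: b_def)
  qed (use t f in \<open>auto simp: b_def countable_vertices infinite_vertices intro: heat_summable\<close>)
  moreover have "(\<Sum>\<^sub>\<infinity>y. laplacian \<omega> \<mu> (\<lambda>z. p z y t) x * \<mu> y * f y) = laplacian \<omega> \<mu> (heat t f) x"
  proof -
    have "(\<Sum>\<^sub>\<infinity>y. laplacian \<omega> \<mu> (\<lambda>z. p z y t) x * \<mu> y * f y) =
        (\<Sum>\<^sub>\<infinity>y. (\<Sum>z\<in>nbrs x. \<omega> x z / \<mu> x * (p z y t * \<mu> y * f y)) + (- deg x) * (p x y t * \<mu> y * f y))"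
      by (simp add: laplacian_eq left_diff_distrib sum_distrib_right mult.assoc)
    also have "\<dots> = (\<Sum>z\<in>nbrs x. \<omega> x z / \<mu> x * heat t f z) + (- deg x) * heat t f x"
      unfolding heat_def
      by (intro infsumI has_sum_add has_sum_sum_finite has_sum_cmult_right has_sum_infsum heat_summable[OF f t] finite_nbrs)
    also have "\<dots> = laplacian \<omega> \<mu> (heat t f) x"
      by (simp add: laplacian_eq)
    finally show ?thesis .
  qed
  ultimately show ?thesis unfolding heat_def by simp
qed

lemma heat_initial:
  assumes f: "\<And>y. \<bar>f y\<bar> \<le> B"
  shows "((\<lambda>t. heat t f x) \<longlongrightarrow> f x) (at_right 0)"
proof -
  have ul: "uniform_limit {0<..<1} (\<lambda>F t. \<Sum>y\<in>F. p x y t * \<mu> y * f y) (\<lambda>t. heat t f x)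
      (finite_subsets_at_top UNIV)"
    unfolding heat_def
  proof (rule Weierstrass_m_test_general)
    show "norm (p x y s * \<mu> y * f y) \<le> exp (deg x * 1) * p x y 1 * \<mu> y * B" if "s \<in> {0<..<1}" for y s
      unfolding real_norm_def using that f by (intro kernel_bound_abs) auto
    show "(\<lambda>y. exp (deg x * 1) * p x y 1 * \<mu> y * B) summable_on UNIV"
      by (rule kernel_bound_summable) simp
  qed
  show ?thesis
  proof (rule swap_uniform_limit'[OF _ _ ul])
    have "((\<lambda>t. p x y t * \<mu> y * f y) \<longlongrightarrow> (if y = x then f x else 0)) (at_right 0)" for y
      using tendsto_mult_right[OF tendsto_mult_right[OF kernel_initial[of x y], of "\<mu> y"], of "f y"]
        measure_pos[of x] by (cases "y = x") auto
    then have "((\<lambda>t. \<Sum>y\<in>F. p x y t * \<mu> y * f y) \<longlongrightarrow> (\<Sum>y\<in>F. if y = x then f x else 0)) (at_right 0)" for F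
      by (intro tendsto_sum)
    then show "\<forall>\<^sub>F F in finite_subsets_at_top UNIV.
        ((\<lambda>t. \<Sum>y\<in>F. p x y t * \<mu> y * f y) \<longlongrightarrow> (\<Sum>y\<in>F. if y = x then f x else 0)) (at_right 0)"
      by simp
    show "((\<lambda>F. \<Sum>y\<in>F. if y = x then f x else 0) \<longlongrightarrow> f x) (finite_subsets_at_top UNIV)"
    proof (rule tendsto_eventually)
      show "\<forall>\<^sub>F F in finite_subsets_at_top UNIV. (\<Sum>y\<in>F. if y = x then f x else 0) = f x"
        unfolding eventually_finite_subsets_at_top by (rule exI[of _ "{x}"]) auto
    qed
    show "\<forall>\<^sub>F t in at_right (0::real). t \<in> {0<..<1}"
      by (rule eventually_at_right_real) simp
  qed auto
qed

text \<open>Fundamental solutions are strictly positive, so a competitor of \<open>p\<close> built from the heat flow must be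
  so as well.\<close>

lemma heat_pos:
  assumes f: "\<And>y. f y > 0" "\<And>y. f y \<le> B" and t: "t > 0"
  shows "heat t f x > 0"
proof -
  have "0 < p x x t * \<mu> x * f x" using f t kernel_pos measure_pos by simp
  also have "\<dots> = infsum (\<lambda>y. p x y t * \<mu> y * f y) {x}" by simp
  also have "\<dots> \<le> heat t f x" unfolding heat_def
    using f t kernel_nonneg measure_pos
    by (intro infsum_mono_neutral heat_summable[where B = B]) (auto simp: less_imp_le intro: kernel_nonneg)
  finally show ?thesis .
qed

text \<open>Half of the Chapman--Kolmogorov identity, from minimality alone: following
  \<open>p(\<sqdot>,z,r)\<close> up to time \<open>s\<close> and then the heat flow started from \<open>p(\<sqdot>,z,s)\<close> gives a positive
  fundamental solution, so it lies above \<open>p\<close>. The two pieces fit together smoothly at \<open>r = s\<close>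
  because the heat flow attains its initial data and the heat equation expresses the time derivative
  by the values themselves.\<close>

lemma kernel_superconvolution:
  assumes s: "s > 0" and t: "t > 0"
  shows "p x z (t + s) \<le> heat t (\<lambda>y. p y z s) x"
proof -
  \<comment> \<open>only the column \<open>z\<close> of the kernel is changed\<close>
  define P where "P x y r = (if y = z \<and> r > s then heat (r - s) (\<lambda>y. p y z s) x else p x y r)" for x y r
  have bnd: "\<bar>p y z s\<bar> \<le> 1 / \<mu> z" for y
    using kernel_measure_le_1[OF s, of y z] kernel_nonneg[OF s, of y z] measure_pos[of z]
    by (simp add: field_simps)
  have Ppos: "P x y r > 0" if "r > 0" for x y r
    unfolding P_def using that s bnd kernel_pos
    by (auto intro!: heat_pos[where B = "1 / \<mu> z"] dest: abs_le_D1)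
  have D_less: "((\<lambda>r. P x z r) has_real_derivative laplacian \<omega> \<mu> (\<lambda>y. P y z r) x) (at r)" if "0 < r" "r < s" for x r
  proof (rule has_field_derivative_transform_within_open[of "\<lambda>r. p x z r" _ _ "{..<s}"])
    show "((\<lambda>r. p x z r) has_real_derivative laplacian \<omega> \<mu> (\<lambda>y. P y z r) x) (at r)"
      using kernel_DERIV[of r x z] that by (simp add: P_def)
  qed (use that in \<open>auto simp: P_def\<close>)
  have D_greater: "((\<lambda>r. P x z r) has_real_derivative laplacian \<omega> \<mu> (\<lambda>y. P y z r) x) (at r)" if "s < r" for x r
  proof (rule has_field_derivative_transform_within_open[of "\<lambda>r. heat (r - s) (\<lambda>y. p y z s) x" _ _ "{s<..}"])
    have "((\<lambda>r. heat (r - s) (\<lambda>y. p y z s) x) has_real_derivative laplacian \<omega> \<mu> (heat (r - s) (\<lambda>y. p y z s)) x) (at r)"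
      using DERIV_shift[where f = "\<lambda>r. heat r (\<lambda>y. p y z s) x" and x = r and z = "-s"] heat_DERIV[where f = "\<lambda>y. p y z s", OF bnd, where t = "r - s" and x = x] that
      by simp
    then show "((\<lambda>r. heat (r - s) (\<lambda>y. p y z s) x) has_real_derivative laplacian \<omega> \<mu> (\<lambda>y. P y z r) x) (at r)"
      using that by (simp add: P_def)
  qed (use that in \<open>auto simp: P_def\<close>)
  have cont: "isCont (\<lambda>r. P x z r) s" for x
    unfolding isCont_def
  proof (rule filterlim_split_at)
    have "((\<lambda>r. p x z r) \<longlongrightarrow> p x z s) (at_left s)"
      using DERIV_isCont[OF kernel_DERIV[OF s, of x z]] by (simp add: isCont_def filterlim_at_split)
    then have "((\<lambda>r. p x z r) \<longlongrightarrow> P x z s) (at_left s)" by (simp add: P_def)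
    then show "((\<lambda>r. P x z r) \<longlongrightarrow> P x z s) (at_left s)"
      by (rule Lim_transform_eventually) (auto simp: P_def eventually_at_filter)
    have "((\<lambda>r. heat (r - s) (\<lambda>y. p y z s) x) \<longlongrightarrow> p x z s) (at_right s)"
      using heat_initial[where f = "\<lambda>y. p y z s", OF bnd, where x = x] filterlim_at_right_to_0[of "\<lambda>r. heat (r - s) (\<lambda>y. p y z s) x" _ s] by simp
    then have "((\<lambda>r. heat (r - s) (\<lambda>y. p y z s) x) \<longlongrightarrow> P x z s) (at_right s)" by (simp add: P_def)
    then show "((\<lambda>r. P x z r) \<longlongrightarrow> P x z s) (at_right s)"
      by (rule Lim_transform_eventually) (auto simp: P_def eventually_at_filter)
  qed
  have D_eq: "((\<lambda>r. P x z r) has_real_derivative laplacian \<omega> \<mu> (\<lambda>y. P y z s) x) (at s)" for x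
  proof (rule DERIV_from_limit[OF cont, where D = "\<lambda>r. laplacian \<omega> \<mu> (\<lambda>y. P y z r) x"])
    show "isCont (\<lambda>r. laplacian \<omega> \<mu> (\<lambda>y. P y z r) x) s"
      unfolding laplacian_eq by (intro continuous_intros cont)
    have "\<forall>\<^sub>F r in at s. r \<in> {0<..} - {s}"
      using s by (intro eventually_at_in_open) auto
    then show "\<forall>\<^sub>F r in at s. ((\<lambda>r. P x z r) has_real_derivative laplacian \<omega> \<mu> (\<lambda>y. P y z r) x) (at r)"
      by eventually_elim (metis D_less D_greater DiffE greaterThan_iff linorder_neqE_linordered_idom singletonI)
  qed
  have "positive_fundamental_solution \<omega> \<mu> P"
    unfolding positive_fundamental_solution_def
  proof (intro conjI allI impI)
    show "((\<lambda>r. P x y r) has_real_derivative laplacian \<omega> \<mu> (\<lambda>w. P w y r) x) (at r)" if "r > 0" for x y r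
    proof (cases "y = z")
      case True
      then show ?thesis using D_less[of r x] D_greater[of r x] D_eq[of x] that
        by (cases r s rule: linorder_cases) auto
    next
      case False
      then show ?thesis using kernel_DERIV[OF that] by (simp add: P_def)
    qed
    show "((\<lambda>t. P x y t) \<longlongrightarrow> (if x = y then 1 / \<mu> x else 0)) (at_right 0)" for x y
    proof (rule Lim_transform_eventually[OF kernel_initial[of x y]])
      have "\<forall>\<^sub>F t in at_right 0. t \<in> {0<..<s}"
        by (rule eventually_at_right_real) (rule s)
      then show "\<forall>\<^sub>F t in at_right 0. p x y t = P x y t"
        by eventually_elim (auto simp: P_def)
    qed
  qed (use Ppos in auto)
  from kernel_minimal[OF this, of "t + s" x z] show ?thesis
    using s t by (simp add: P_def)
qed

end

section \<open>Decay of the heat kernel\<close>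

context complete_heat_graph
begin

lemma laplacian_integral:
  assumes "\<And>x. F x integrable_on I"
  shows "laplacian \<omega> \<mu> (\<lambda>x. integral I (F x)) x = integral I (\<lambda>t. laplacian \<omega> \<mu> (\<lambda>x. F x t) x)"
proof -
  have "((\<lambda>t. (\<Sum>y\<in>nbrs x. \<omega> x y / \<mu> x * F y t) - deg x * F x t) has_integral
      (\<Sum>y\<in>nbrs x. \<omega> x y / \<mu> x * integral I (F y)) - deg x * integral I (F x)) I"
    by (intro has_integral_diff has_integral_sum has_integral_mult_right integrable_integral assms finite_nbrs)
  then show ?thesis unfolding laplacian_eq by (simp add: integral_unique)
qed

text \<open>The heat kernel cannot decay faster than the bottom of the spectrum permits. If
  \<open>v(x,t) = e\<^bsup>\<Lambda>t\<^esup> p(x,y,t)\<close> tends to 0, the truncated resolvent \<open>\<psi> = \<integral>\<^sub>1\<^sup>T v dt\<close> satisfies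
  \<open>\<Delta>\<psi> = v(T) - v(1) - \<Lambda>\<psi>\<close>, and for large \<open>T\<close> the boundary terms are negative on any given
  finite set of vertices. So \<open>\<psi>\<close> is a supersolution there and Barta's inequality applies.\<close>

lemma bottom_spectrum_ge_of_decay:
  assumes decay: "\<And>x. ((\<lambda>t. exp (\<Lambda> * t) * p x y t) \<longlongrightarrow> 0) at_top"
  shows "\<Lambda> \<le> bottom_spectrum \<omega> \<mu>"
proof (rule bottom_spectrum_ge)
  fix f :: "'a \<Rightarrow> real" assume fin: "finite {x. f x \<noteq> 0}"
  have "\<forall>\<^sub>F T in at_top. \<forall>x\<in>{x. f x \<noteq> 0}. exp (\<Lambda> * T) * p x y T < exp \<Lambda> * p x y 1"
    using fin by (intro eventually_ball_finite ballI order_tendstoD(2)[OF decay]) (auto simp: kernel_pos)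
  then obtain T where T: "T > 1" "\<And>x. f x \<noteq> 0 \<Longrightarrow> exp (\<Lambda> * T) * p x y T < exp \<Lambda> * p x y 1"
    using eventually_happens[OF eventually_conj[OF eventually_gt_at_top[of "1::real"]]] by fastforce
  define v where "v x t = exp (\<Lambda> * t) * p x y t" for x t
  have D: "(v x has_real_derivative laplacian \<omega> \<mu> (\<lambda>x. v x t) x + \<Lambda> * v x t) (at t)" if "t > 0" for x t
    unfolding v_def using that
    by (auto intro!: derivative_eq_intros kernel_DERIV simp: laplacian_eq algebra_simps sum_distrib_left)
  have cont: "continuous_on {1..T} (v x)" for x
    by (intro continuous_at_imp_continuous_on ballI DERIV_isCont[OF D]) auto
  have int: "v x integrable_on {1..T}" for x
    by (rule integrable_continuous_real[OF cont])
  define \<psi> where "\<psi> x = integral {1..T} (v x)" for x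
  have pos: "\<psi> x > 0" for x
  proof -
    have "\<psi> x \<ge> 0" unfolding \<psi>_def by (intro integral_nonneg int) (auto simp: v_def kernel_nonneg)
    moreover have "\<psi> x \<noteq> 0"
      unfolding \<psi>_def using T(1) integral_eq_0_iff[OF cont, of x] kernel_pos[of 1 x y]
      by (auto simp: v_def kernel_nonneg) 
    ultimately show ?thesis by simp
  qed
  have "laplacian \<omega> \<mu> \<psi> x = v x T - v x 1 - \<Lambda> * \<psi> x" for x
  proof -
    have "((\<lambda>t. laplacian \<omega> \<mu> (\<lambda>x. v x t) x + \<Lambda> * v x t) has_integral (v x T - v x 1)) {1..T}"
      using T(1) by (intro fundamental_theorem_of_calculus)
        (auto intro!: has_field_derivative_at_within[OF D] simp flip: has_real_derivative_iff_has_vector_derivative)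
    moreover have "((\<lambda>t. \<Lambda> * v x t) has_integral (\<Lambda> * \<psi> x)) {1..T}"
      unfolding \<psi>_def by (intro has_integral_mult_right integrable_integral int)
    ultimately have "((\<lambda>t. laplacian \<omega> \<mu> (\<lambda>x. v x t) x + \<Lambda> * v x t - \<Lambda> * v x t) has_integral (v x T - v x 1 - \<Lambda> * \<psi> x)) {1..T}"
      by (rule has_integral_diff)
    then show ?thesis
      unfolding \<psi>_def using laplacian_integral[of v "{1..T}" x, OF int] by (simp add: integral_unique)
  qed
  then have "laplacian \<omega> \<mu> \<psi> x \<le> - \<Lambda> * \<psi> x" if "f x \<noteq> 0" for x
    using T(2)[OF that] by (simp add: v_def)
  with pos show "\<exists>\<psi>. (\<forall>x. \<psi> x > 0) \<and> (\<forall>x. f x \<noteq> 0 \<longrightarrow> laplacian \<omega> \<mu> \<psi> x \<le> - \<Lambda> * \<psi> x)"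
    by blast
qed

end

section \<open>The heat operator and Duhamel's formula with values in \<open>[0, \<infinity>]\<close>\<close>

context complete_heat_graph
begin

text \<open>With values in \<open>[0, \<infinity>]\<close> the heat operator exists for every nonnegative function, and sums
  over vertices may be exchanged with time integrals of measurable functions.\<close>

definition nheat :: "real \<Rightarrow> ('a \<Rightarrow> ennreal) \<Rightarrow> 'a \<Rightarrow> ennreal" where
  "nheat t F x = (\<integral>\<^sup>+y. ennreal (p x y t * \<mu> y) * F y \<partial>count_space UNIV)"

lemma weight_kernel_nonneg: "t > 0 \<Longrightarrow> p x y t * \<mu> y \<ge> 0"
  using kernel_nonneg measure_pos by (simp add: less_imp_le)

lemma nheat_mono: "(\<And>y. F y \<le> G y) \<Longrightarrow> nheat t F x \<le> nheat t G x"
  unfolding nheat_def by (intro nn_integral_mono mult_left_mono) auto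

lemma nheat_const: "t > 0 \<Longrightarrow> nheat t (\<lambda>_. c) x = c"
  unfolding nheat_def
  using kernel_mass[of t x]
  by (simp add: nn_integral_multc nn_integral_count_space_infsum weight_kernel_nonneg kernel_summable infsumI)

lemma nheat_le:
  assumes "t > 0" "\<And>y. F y \<le> c" shows "nheat t F x \<le> c"
  using nheat_mono[of F "\<lambda>_. c" t x] nheat_const[OF assms(1), of c x] assms(2) by simp

lemma nheat_add: "nheat t (\<lambda>y. F y + G y) x = nheat t F x + nheat t G x"
  unfolding nheat_def by (simp add: distrib_left nn_integral_add)

lemma nheat_cmult: "nheat t (\<lambda>y. c * F y) x = c * nheat t F x"
  unfolding nheat_def by (simp add: nn_integral_cmult[symmetric] mult.left_commute)

lemma nheat_ge: "ennreal (p x y t * \<mu> y) * F y \<le> nheat t F x"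
proof -
  have "ennreal (p x y t * \<mu> y) * F y = (\<integral>\<^sup>+y. ennreal (p x y t * \<mu> y) * F y \<partial>count_space {y})"
    by (simp add: nn_integral_count_space_finite)
  also have "\<dots> = (\<integral>\<^sup>+z. (ennreal (p x z t * \<mu> z) * F z) * indicator {y} z \<partial>count_space UNIV)"
    by (subst nn_integral_count_space_indicator) auto
  also have "\<dots> \<le> nheat t F x"
    unfolding nheat_def by (intro nn_integral_mono) (auto simp: indicator_def)
  finally show ?thesis .
qed

lemma nheat_ennreal:
  assumes "\<And>y. 0 \<le> f y" "\<And>y. f y \<le> B" "t > 0"
  shows "nheat t (\<lambda>y. ennreal (f y)) x = ennreal (heat t f x)"
proof -
  have "nheat t (\<lambda>y. ennreal (f y)) x = (\<integral>\<^sup>+y. ennreal (p x y t * \<mu> y * f y) \<partial>count_space UNIV)"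
    unfolding nheat_def using assms by (simp add: ennreal_mult weight_kernel_nonneg)
  also have "\<dots> = ennreal (heat t f x)"
    unfolding heat_def using assms
    by (intro nn_integral_count_space_infsum heat_summable[where B = B]) (auto simp: weight_kernel_nonneg)
  finally show ?thesis .
qed

lemma nheat_superadditive:
  assumes t: "t > 0" and s: "s > 0"
  shows "nheat (t + s) F x \<le> nheat t (nheat s F) x"
proof -
  have "ennreal (p x z (t + s) * \<mu> z) \<le> (\<integral>\<^sup>+y. ennreal (p x y t * \<mu> y) * ennreal (p y z s * \<mu> z) \<partial>count_space UNIV)" for z
  proof -
    have b: "p y z s \<le> 1 / \<mu> z" for y
      using kernel_measure_le_1[OF s, of y z] measure_pos[of z] by (simp add: field_simps)
    have "ennreal (p x z (t + s) * \<mu> z) \<le> ennreal (heat t (\<lambda>y. p y z s) x * \<mu> z)"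
      using measure_pos[of z] by (intro ennreal_leI mult_right_mono kernel_superconvolution s t) auto
    also have "\<dots> = nheat t (\<lambda>y. ennreal (p y z s)) x * ennreal (\<mu> z)"
      using kernel_nonneg[OF s] b t measure_pos[of z]
      by (subst nheat_ennreal[where B = "1 / \<mu> z"])
         (auto intro!: ennreal_mult infsum_nonneg simp: heat_def weight_kernel_nonneg)
    also have "\<dots> = nheat t (\<lambda>y. ennreal (p y z s * \<mu> z)) x"
      unfolding nheat_def using kernel_nonneg[OF s] measure_pos[of z]
      by (subst nn_integral_multc[symmetric]) (auto simp: ennreal_mult mult.assoc)
    finally show ?thesis unfolding nheat_def .
  qed
  then have "nheat (t + s) F x \<le> (\<integral>\<^sup>+z. (\<integral>\<^sup>+y. ennreal (p x y t * \<mu> y) * ennreal (p y z s * \<mu> z) \<partial>count_space UNIV) * F z \<partial>count_space UNIV)"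
    unfolding nheat_def by (intro nn_integral_mono mult_right_mono) auto
  also have "\<dots> = (\<integral>\<^sup>+z. \<integral>\<^sup>+y. ennreal (p x y t * \<mu> y) * (ennreal (p y z s * \<mu> z) * F z) \<partial>count_space UNIV \<partial>count_space UNIV)"
    by (simp add: nn_integral_multc[symmetric] mult.assoc)
  also have "\<dots> = (\<integral>\<^sup>+y. \<integral>\<^sup>+z. ennreal (p x y t * \<mu> y) * (ennreal (p y z s * \<mu> z) * F z) \<partial>count_space UNIV \<partial>count_space UNIV)"
    by (rule nn_integral_count_space_nn_integral) (auto simp: countable_vertices)
  also have "\<dots> = nheat t (nheat s F) x"
    unfolding nheat_def by (simp add: nn_integral_cmult)
  finally show ?thesis .
qed

lemma nheat_nn_integral:
  assumes "\<And>y. (\<lambda>s. F s y) \<in> borel_measurable M"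
  shows "nheat t (\<lambda>y. \<integral>\<^sup>+s. F s y \<partial>M) x = (\<integral>\<^sup>+s. nheat t (F s) x \<partial>M)"
proof -
  have "(\<integral>\<^sup>+s. nheat t (F s) x \<partial>M) = (\<integral>\<^sup>+y. \<integral>\<^sup>+s. ennreal (p x y t * \<mu> y) * F s y \<partial>M \<partial>count_space UNIV)"
    unfolding nheat_def by (rule nn_integral_count_space_nn_integral) (use assms countable_vertices in auto)
  then show ?thesis
    unfolding nheat_def by (simp add: nn_integral_cmult assms)
qed

text \<open>Jensen's inequality for the probability measure \<open>p(x,\<sqdot>,t) \<mu>\<close>, obtained by summing Young's
  inequality \<open>q a\<^bsup>q-1\<^esup> b \<le> b\<^sup>q + (q - 1) a\<^sup>q\<close> over \<open>b = v(y)\<close>. Stochastic completeness makes the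
  constant \<open>(q - 1) a\<^sup>q\<close> survive the summation unchanged.\<close>

lemma nheat_jensen:
  assumes t: "t > 0" and q: "q > 1" and v: "\<And>y. v y \<ge> 0"
    and a: "a \<ge> 0" "ennreal a \<le> nheat t (\<lambda>y. ennreal (v y)) x"
  shows "ennreal (a powr q) \<le> nheat t (\<lambda>y. ennreal (v y powr q)) x"
proof (cases "a = 0")
  case False
  with a have a0: "a > 0" by simp
  have young: "q * a powr (q - 1) * b \<le> b powr q + (q - 1) * a powr q" if "b \<ge> 0" for b
  proof (cases "b = 0")
    case False
    have "(a powr q) powr (1 - 1 / q) * (b powr q) powr (1 / q) \<le> (1 - 1 / q) * a powr q + 1 / q * b powr q"
      by (rule Youngs_inequality_0) (use q a0 that False in auto)
    also have "(a powr q) powr (1 - 1 / q) = a powr (q - 1)"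
      using q by (simp add: powr_powr right_diff_distrib)
    also have "(b powr q) powr (1 / q) = b"
      using q that by (simp add: powr_powr)
    finally show ?thesis using q by (simp add: field_simps)
  qed (use q in simp)
  have "ennreal (q * a powr (q - 1)) * ennreal a \<le> ennreal (q * a powr (q - 1)) * nheat t (\<lambda>y. ennreal (v y)) x"
    by (intro mult_left_mono a) auto
  also have "\<dots> = nheat t (\<lambda>y. ennreal (q * a powr (q - 1) * v y)) x"
    using q by (subst nheat_cmult[symmetric]) (auto simp: ennreal_mult v)
  also have "\<dots> \<le> nheat t (\<lambda>y. ennreal (v y powr q) + ennreal ((q - 1) * a powr q)) x"
    using q young[OF v] by (intro nheat_mono) (auto simp flip: ennreal_plus intro!: ennreal_leI)
  also have "\<dots> = nheat t (\<lambda>y. ennreal (v y powr q)) x + ennreal ((q - 1) * a powr q)"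
    by (simp add: nheat_add nheat_const t)
  also have "ennreal (q * a powr (q - 1)) * ennreal a = ennreal (a powr q) + ennreal ((q - 1) * a powr q)"
  proof -
    have "a powr (q - 1) * a = a powr q" using a0 by (simp add: powr_diff)
    then have "q * a powr (q - 1) * a = a powr q + (q - 1) * a powr q" by (simp add: algebra_simps)
    then show ?thesis using q a by (simp flip: ennreal_mult ennreal_plus)
  qed
  finally show ?thesis by (simp add: add.commute[of _ "ennreal ((q - 1) * a powr q)"])
qed simp

text \<open>The Duhamel integral for the source \<open>F\<close>, cut off at time \<open>r\<close> but observed at time \<open>t\<close>. Keeping
  the two times apart allows sources to be followed past \<open>r\<close> by the heat flow.\<close>

definition duhamel :: "real \<Rightarrow> real \<Rightarrow> (real \<Rightarrow> 'a \<Rightarrow> ennreal) \<Rightarrow> 'a \<Rightarrow> ennreal" where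
  "duhamel t r F x = (\<integral>\<^sup>+s. indicator {0<..<r} s * nheat (t - s) (F s) x \<partial>lebesgue)"

text \<open>Nothing is known about the kernel at times \<open>t \<le> 0\<close>, so they are masked.\<close>

lemma kernel_measurable:
  "(\<lambda>t. indicator {0<..} t * ennreal (p x y t * \<mu> y)) \<in> borel_measurable borel"
proof -
  have "(\<lambda>t. indicator {0<..} t *\<^sub>R (p x y t * \<mu> y)) \<in> borel_measurable borel"
  proof (rule borel_measurable_continuous_on_indicator)
    show "continuous_on {0<..} (\<lambda>t. p x y t * \<mu> y)"
      by (intro continuous_intros continuous_at_imp_continuous_on)
         (auto intro!: DERIV_isCont[OF kernel_DERIV])
  qed simp
  then have "(\<lambda>t. ennreal (indicator {0<..} t *\<^sub>R (p x y t * \<mu> y))) \<in> borel_measurable borel" by measurable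
  moreover have "ennreal (indicator {0<..} t *\<^sub>R (p x y t * \<mu> y)) = indicator {0<..} t * ennreal (p x y t * \<mu> y)" for t
    by (auto simp: indicator_def)
  ultimately show ?thesis by simp
qed

lemma nheat_measurable:
  assumes F: "\<And>y. (\<lambda>s. F s y) \<in> borel_measurable lebesgue" and A: "A \<in> sets borel" "A \<subseteq> {..<t}"
  shows "(\<lambda>s. indicator A s * nheat (t - s) (F s) x) \<in> borel_measurable lebesgue"
proof -
  have *: "indicator A s * nheat (t - s) (F s) x
      = (\<integral>\<^sup>+y. indicator A s * (indicator {0<..} (t - s) * ennreal (p x y (t - s) * \<mu> y)) * F s y \<partial>count_space UNIV)" for s
    using A(2) by (cases "s \<in> A") (auto simp: nheat_def indicator_def)
  have k: "(\<lambda>s. indicator {0<..} (t - s) * ennreal (p x y (t - s) * \<mu> y)) \<in> borel_measurable lebesgue" for y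
  proof -
    have "(\<lambda>s. indicator {0<..} (t - s) * ennreal (p x y (t - s) * \<mu> y)) \<in> borel_measurable lborel"
      using measurable_compose[OF _ kernel_measurable[of x y], of "\<lambda>s. t - s" lborel] by simp
    then show ?thesis by (rule measurable_completion)
  qed
  have i: "(indicator A :: real \<Rightarrow> ennreal) \<in> borel_measurable lebesgue"
    using A(1) by (intro borel_measurable_indicator) (simp add: sets_completionI_sets)
  show ?thesis unfolding *
    by (intro borel_measurable_nn_integral_count_space countable_vertices borel_measurable_times_ennreal i k F)
qed

text \<open>Joint measurability in both times is available for Borel sources; a Lebesgue measurable source is
  therefore first replaced, simultaneously at all of the countably many vertices, by a Borel
  version.\<close>

lemma duhamel_measurable:
  assumes F: "\<And>y. (\<lambda>s. F s y) \<in> borel_measurable lebesgue"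
  shows "(\<lambda>t. duhamel t t F x) \<in> borel_measurable borel"
proof -
  have "\<exists>g. g \<in> borel_measurable lborel \<and> (AE s in lborel. F s y = g s)" for y
    using completion_ex_borel_measurable[OF F] by blast
  then obtain G where G[measurable]: "\<And>y. G y \<in> borel_measurable lborel"
    and FG: "\<And>y. AE s in lborel. F s y = G y s" by metis
  have "AE s in lborel. \<forall>y\<in>UNIV. F s y = G y s"
    by (subst AE_ball_countable[OF countable_vertices]) (use FG in auto)
  then have FG': "AE s in lborel. F s = (\<lambda>y. G y s)" by eventually_elim auto
  let ?K = "\<lambda>y t s. indicator {0<..<t} s * (indicator {0<..} (t - s) * ennreal (p x y (t - s) * \<mu> y)) * G y s :: ennreal"
  have "duhamel t t F x = (\<integral>\<^sup>+y. (\<integral>\<^sup>+s. ?K y t s \<partial>lborel) \<partial>count_space UNIV)" for t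
  proof -
    have m: "?K y t \<in> borel_measurable lborel" for y
      by (intro borel_measurable_times_ennreal measurable_compose[OF _ kernel_measurable[of x y], of "\<lambda>s. t - s" lborel] G) auto
    have "duhamel t t F x = (\<integral>\<^sup>+s. indicator {0<..<t} s * nheat (t - s) (F s) x \<partial>lborel)"
      unfolding duhamel_def by (rule nn_integral_completion)
    also have "\<dots> = (\<integral>\<^sup>+s. \<integral>\<^sup>+y. ?K y t s \<partial>count_space UNIV \<partial>lborel)"
    proof (rule nn_integral_cong_AE)
      show "AE s in lborel. indicator {0<..<t} s * nheat (t - s) (F s) x = (\<integral>\<^sup>+y. ?K y t s \<partial>count_space UNIV)"
        using FG' by eventually_elim (auto simp: nheat_def indicator_def)
    qed
    also have "\<dots> = (\<integral>\<^sup>+y. (\<integral>\<^sup>+s. ?K y t s \<partial>lborel) \<partial>count_space UNIV)"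
      by (rule nn_integral_count_space_nn_integral[OF countable_vertices m])
    finally show ?thesis .
  qed
  moreover have "(\<lambda>t. \<integral>\<^sup>+s. ?K y t s \<partial>lborel) \<in> borel_measurable borel" for y
  proof (rule lborel.borel_measurable_nn_integral)
    have "(\<lambda>(t, s). indicator {0<..} (t - s) * ennreal (p x y (t - s) * \<mu> y)) \<in> borel_measurable (borel \<Otimes>\<^sub>M lborel)"
      using measurable_compose[OF _ kernel_measurable[of x y], of "\<lambda>(t, s). t - s" "borel \<Otimes>\<^sub>M lborel"]
      by (simp add: split_def)
    moreover have "(\<lambda>(t :: real, s). indicator {0<..<t} s :: ennreal) \<in> borel_measurable (borel \<Otimes>\<^sub>M lborel)"
    proof -
      have "open {z :: real \<times> real. 0 < snd z \<and> snd z < fst z}"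
        by (intro open_Collect_conj open_Collect_less continuous_intros)
      then have "indicator {z :: real \<times> real. 0 < snd z \<and> snd z < fst z} \<in> borel_measurable (borel \<Otimes>\<^sub>M borel :: (real \<times> real) measure)"
        unfolding borel_prod by (intro borel_measurable_indicator borel_open)
      then have "(indicator {z :: real \<times> real. 0 < snd z \<and> snd z < fst z} :: _ \<Rightarrow> ennreal) \<in> borel_measurable (borel \<Otimes>\<^sub>M lborel)"
        by (simp cong: measurable_cong_sets sets_pair_measure_cong)
      moreover have "(\<lambda>(t :: real, s). indicator {0<..<t} s :: ennreal) = indicator {z :: real \<times> real. 0 < snd z \<and> snd z < fst z}"
        by (auto simp: indicator_def)
      ultimately show ?thesis by (simp only:)
    qed
    moreover have "(\<lambda>(t, s). G y s) \<in> borel_measurable (borel \<Otimes>\<^sub>M lborel)"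
      by measurable
    ultimately show "(\<lambda>(t, s). ?K y t s) \<in> borel_measurable (borel \<Otimes>\<^sub>M lborel)"
      by (simp add: split_def borel_measurable_times_ennreal)
  qed
  ultimately show ?thesis
    by (simp add: borel_measurable_nn_integral_count_space countable_vertices)
qed

lemma duhamel_mono:
  assumes "\<And>s y. 0 < s \<Longrightarrow> s < r \<Longrightarrow> F s y \<le> G s y"
  shows "duhamel t r F x \<le> duhamel t r G x"
  unfolding duhamel_def by (intro nn_integral_mono) (auto simp: indicator_def intro!: nheat_mono assms)

text \<open>By \<open>nheat_superadditive\<close>, restarting the Duhamel formula at an intermediate time can only
  increase it. Both halves of the theorem rest on this inequality in this direction.\<close>

lemma nheat_restart:
  assumes r: "0 < r" "r < t" and F: "\<And>y. (\<lambda>s. F s y) \<in> borel_measurable lebesgue"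
  shows "nheat t U x + duhamel t r F x \<le> nheat (t - r) (\<lambda>y. nheat r U y + duhamel r r F y) x"
proof -
  have "duhamel t r F x \<le> (\<integral>\<^sup>+s. nheat (t - r) (\<lambda>y. indicator {0<..<r} s * nheat (r - s) (F s) y) x \<partial>lebesgue)"
    unfolding duhamel_def
  proof (rule nn_integral_mono)
    fix s
    show "indicator {0<..<r} s * nheat (t - s) (F s) x \<le> nheat (t - r) (\<lambda>y. indicator {0<..<r} s * nheat (r - s) (F s) y) x"
      using nheat_superadditive[of "t - r" "r - s" "F s" x] r
      by (cases "s \<in> {0<..<r}") (auto simp: nheat_cmult)
  qed
  also have "\<dots> = nheat (t - r) (duhamel r r F) x"
    unfolding duhamel_def[abs_def] by (rule nheat_nn_integral[symmetric]) (auto intro!: nheat_measurable F)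
  finally show ?thesis
    using nheat_superadditive[of "t - r" r U x] r by (auto simp: nheat_add intro!: add_mono)
qed

lemma duhamel_cong:
  assumes "\<And>s y. 0 < s \<Longrightarrow> s < r \<Longrightarrow> F s y = G s y"
  shows "duhamel t r F x = duhamel t r G x"
  using assms by (intro antisym duhamel_mono) auto

lemma nheat_time_measurable:
  "(\<lambda>t. indicator {0<..} t * nheat t F x) \<in> borel_measurable borel"
proof -
  have "indicator {0<..} t * nheat t F x = (\<integral>\<^sup>+y. indicator {0<..} t * ennreal (p x y t * \<mu> y) * F y \<partial>count_space UNIV)" for t
    by (cases "t > 0") (auto simp: nheat_def)
  then show ?thesis
    by (simp only:) (intro borel_measurable_nn_integral_count_space countable_vertices borel_measurable_times_ennreal kernel_measurable borel_measurable_const)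
qed

lemma nheat_LIMSEQ:
  assumes "\<And>n y. F n y \<le> F (Suc n) y" "\<And>y. (\<lambda>n. F n y) \<longlonglongrightarrow> G y"
  shows "(\<lambda>n. nheat t (F n) x) \<longlonglongrightarrow> nheat t G x"
  unfolding nheat_def
proof (rule nn_integral_LIMSEQ)
  show "incseq (\<lambda>n y. ennreal (p x y t * \<mu> y) * F n y)"
    using assms(1) by (intro incseq_SucI le_funI mult_left_mono) auto
  show "(\<lambda>n. ennreal (p x y t * \<mu> y) * F n y) \<longlonglongrightarrow> ennreal (p x y t * \<mu> y) * G y" for y
    by (intro ennreal_tendsto_cmult assms(2)) auto
qed auto

lemma duhamel_LIMSEQ:
  assumes F: "\<And>n y. (\<lambda>s. F n s y) \<in> borel_measurable lebesgue"
    and "\<And>n s y. F n s y \<le> F (Suc n) s y" "\<And>s y. (\<lambda>n. F n s y) \<longlonglongrightarrow> G s y"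
  shows "(\<lambda>n. duhamel t t (F n) x) \<longlonglongrightarrow> duhamel t t G x"
  unfolding duhamel_def
proof (rule nn_integral_LIMSEQ)
  show "incseq (\<lambda>n s. indicator {0<..<t} s * nheat (t - s) (F n s) x)"
    using assms(2) by (intro incseq_SucI le_funI mult_left_mono nheat_mono) auto
  show "(\<lambda>n. indicator {0<..<t} s * nheat (t - s) (F n s) x) \<longlonglongrightarrow> indicator {0<..<t} s * nheat (t - s) (G s) x" for s
    by (intro ennreal_tendsto_cmult nheat_LIMSEQ assms) (auto simp: indicator_def)
qed (auto intro!: nheat_measurable F)

end

section \<open>Mild solutions\<close>

lemma linf_norm_le_iff: "linf_norm f \<le> ereal M \<longleftrightarrow> (\<forall>x. \<bar>f x\<bar> \<le> M)"
  unfolding linf_norm_def by (simp add: SUP_le_iff)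

locale semilinear_heat_problem = complete_heat_graph +
  fixes h :: "real \<Rightarrow> real" and q :: real and u\<^sub>0 :: "'a \<Rightarrow> real" and K\<^sub>0 :: real
  assumes q: "q > 1"
    and u\<^sub>0_nonneg: "u\<^sub>0 x \<ge> 0" and u\<^sub>0_le: "u\<^sub>0 x \<le> K\<^sub>0"
    and h_nonneg: "t \<ge> 0 \<Longrightarrow> h t \<ge> 0"
    and h_integrable: "t \<ge> 0 \<Longrightarrow> set_integrable lebesgue {0..t} h"
begin

definition H :: "real \<Rightarrow> real" where
  "H t = (LINT s:{0..t}|lebesgue. h s)"

lemma K\<^sub>0_nonneg: "K\<^sub>0 \<ge> 0"
  using u\<^sub>0_nonneg u\<^sub>0_le order_trans by blast

lemma H_eq_integral: "t \<ge> 0 \<Longrightarrow> H t = integral {0..t} h"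
  unfolding H_def by (intro set_lebesgue_integral_eq_integral h_integrable)

lemma H_0: "H 0 = 0"
  by (simp add: H_eq_integral)

lemma H_continuous: "continuous_on {0..T} H"
proof (cases "T \<ge> 0")
  case True
  have "continuous_on {0..T} (\<lambda>t. integral {0..t} h)"
    by (rule indefinite_integral_continuous_1)
       (use h_integrable[OF True] set_lebesgue_integral_eq_integral in blast)
  then show ?thesis
    by (rule continuous_on_eq) (simp add: H_eq_integral)
qed simp

lemma H_nn_integral:
  assumes "0 \<le> a" "a \<le> b"
  shows "(\<integral>\<^sup>+s. indicator {a<..<b} s * ennreal (h s) \<partial>lebesgue) = ennreal (H b - H a)"
    and "H a \<le> H b"
proof -
  have i: "set_integrable lebesgue {a..b} h" "set_integrable lebesgue {0..a} h" "set_integrable lebesgue {a<..<b} h"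
    using h_integrable[of b] h_integrable[of a] assms by (auto intro: set_integrable_subset)
  have "(\<integral>\<^sup>+s. indicator {a<..<b} s * ennreal (h s) \<partial>lebesgue) = (\<integral>\<^sup>+s. ennreal (indicator {a<..<b} s *\<^sub>R h s) \<partial>lebesgue)"
    by (intro nn_integral_cong) (auto simp: indicator_def)
  also have "\<dots> = ennreal (LINT s:{a<..<b}|lebesgue. h s)"
    unfolding set_lebesgue_integral_def
    using i(3) assms h_nonneg
    by (intro nn_integral_eq_integral) (auto simp: set_integrable_def indicator_def)
  also have "(LINT s:{a<..<b}|lebesgue. h s) = (LINT s:{a..b}|lebesgue. h s)"
    using set_lebesgue_integral_eq_integral(2)[OF i(3)] set_lebesgue_integral_eq_integral(2)[OF i(1)]
    by (simp add: integral_open_interval_real)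
  also have e: "(LINT s:{a..b}|lebesgue. h s) = H b - H a"
  proof -
    have "integral {0..a} h + integral {a..b} h = integral {0..b} h"
      by (rule Henstock_Kurzweil_Integration.integral_combine)
         (use assms h_integrable[of b] set_lebesgue_integral_eq_integral(1) in auto)
    then show ?thesis
      using set_lebesgue_integral_eq_integral(2)[OF i(1)] set_lebesgue_integral_eq_integral(2)[OF i(2)]
        set_lebesgue_integral_eq_integral(2)[OF h_integrable[of b]] assms
      by (simp add: H_def)
  qed
  finally show "(\<integral>\<^sup>+s. indicator {a<..<b} s * ennreal (h s) \<partial>lebesgue) = ennreal (H b - H a)" .
  have "0 \<le> (LINT s:{a..b}|lebesgue. h s)"
    unfolding set_lebesgue_integral_def using assms h_nonneg
    by (intro Bochner_Integration.integral_nonneg) (auto simp: indicator_def)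
  then show "H a \<le> H b" using e by simp
qed

lemma h_window_measurable:
  assumes "0 \<le> a" "a \<le> b"
  shows "(\<lambda>s. indicator {a<..<b} s * ennreal (h s)) \<in> borel_measurable lebesgue"
proof -
  have "set_integrable lebesgue {a<..<b} h"
    using h_integrable[of b] assms by (auto intro: set_integrable_subset)
  then have "(\<lambda>s. ennreal (indicator {a<..<b} s *\<^sub>R h s)) \<in> borel_measurable lebesgue"
    unfolding set_integrable_def by (intro measurable_compose[OF borel_measurable_integrable measurable_ennreal])
  moreover have "ennreal (indicator {a<..<b} s *\<^sub>R h s) = indicator {a<..<b} s * ennreal (h s)" for s
    by (auto simp: indicator_def)
  ultimately show ?thesis by simp
qed

lemma H_nonneg: "t \<ge> 0 \<Longrightarrow> H t \<ge> 0"
  using H_nn_integral(2)[of 0 t] H_0 by simp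

text \<open>The reaction term, cut off outside of the existence interval so that it is measurable on the whole
  line.\<close>

definition source :: "real \<Rightarrow> ('a \<Rightarrow> real \<Rightarrow> real) \<Rightarrow> real \<Rightarrow> 'a \<Rightarrow> ennreal" where
  "source \<tau> w s y = indicator {0<..<\<tau>} s * ennreal (h s * w y s powr q)"

text \<open>Separated from the equation because the iterates in \<open>bounded_solution_extends\<close> satisfy these
  conditions before they satisfy the equation.\<close>

definition admissible :: "real \<Rightarrow> ('a \<Rightarrow> real \<Rightarrow> real) \<Rightarrow> bool" where
  "admissible \<tau> w \<longleftrightarrow> (\<forall>y. \<forall>s\<in>{0<..<\<tau>}. w y s \<ge> 0) \<and>
     (\<forall>y. (\<lambda>s. w y s) \<in> borel_measurable (lebesgue_on {0<..<\<tau>}))"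

lemma source_measurable:
  assumes "admissible \<tau> w"
  shows "(\<lambda>s. source \<tau> w s y) \<in> borel_measurable lebesgue"
proof (cases "\<tau> > 0")
  case True
  have "(\<lambda>s. indicator {0<..<\<tau>} s *\<^sub>R w y s) \<in> borel_measurable lebesgue"
    using assms borel_measurable_restrict_space_iff[of "{0<..<\<tau>}" lebesgue "w y"]
    by (simp add: admissible_def)
  moreover have "(\<lambda>s. indicator {0..\<tau>} s *\<^sub>R h s) \<in> borel_measurable lebesgue"
    using h_integrable[of \<tau>] True by (simp add: set_integrable_def borel_measurable_integrable)
  moreover have "(indicator {0<..<\<tau>} :: real \<Rightarrow> ennreal) \<in> borel_measurable lebesgue"
    by (intro borel_measurable_indicator) simp
  ultimately have "(\<lambda>s. indicator {0<..<\<tau>} s * ennreal ((indicator {0..\<tau>} s *\<^sub>R h s) * (indicator {0<..<\<tau>} s *\<^sub>R w y s) powr q)) \<in> borel_measurable lebesgue"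
    by measurable
  moreover have "indicator {0<..<\<tau>} s * ennreal ((indicator {0..\<tau>} s *\<^sub>R h s) * (indicator {0<..<\<tau>} s *\<^sub>R w y s) powr q) = source \<tau> w s y" for s
    by (auto simp: source_def indicator_def)
  ultimately show ?thesis by simp
qed (simp add: source_def indicator_def)

lemma source_le:
  assumes "admissible \<tau> w" "0 < s" "s < \<tau>" "\<And>y. w y s \<le> M" "r > 0"
  shows "nheat r (source \<tau> w s) x \<le> ennreal (M powr q) * ennreal (h s)"
proof (rule nheat_le[OF assms(5)])
  fix y
  have "h s * w y s powr q \<le> h s * M powr q"
    using assms q by (intro mult_left_mono powr_mono2 h_nonneg) (auto simp: admissible_def)
  then show "source \<tau> w s y \<le> ennreal (M powr q) * ennreal (h s)"
    using assms h_nonneg[of s] by (auto simp: source_def ennreal_mult[symmetric] mult.commute intro: ennreal_leI)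
qed

lemma duhamel_window_le:
  assumes w: "admissible \<tau> w" and ab: "0 \<le> a" "a \<le> b" "b \<le> \<tau>" "b \<le> t"
    and M: "AE s in lebesgue. a < s \<and> s < b \<longrightarrow> (\<forall>y. w y s \<le> M)"
  shows "(\<integral>\<^sup>+s. indicator {a<..<b} s * nheat (t - s) (source \<tau> w s) x \<partial>lebesgue) \<le> ennreal (M powr q * (H b - H a))"
proof -
  have "(\<integral>\<^sup>+s. indicator {a<..<b} s * nheat (t - s) (source \<tau> w s) x \<partial>lebesgue)
      \<le> (\<integral>\<^sup>+s. ennreal (M powr q) * (indicator {a<..<b} s * ennreal (h s)) \<partial>lebesgue)"
  proof (rule nn_integral_mono_AE, use M in eventually_elim)
    fix s assume "a < s \<and> s < b \<longrightarrow> (\<forall>y. w y s \<le> M)"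
    then show "indicator {a<..<b} s * nheat (t - s) (source \<tau> w s) x \<le> ennreal (M powr q) * (indicator {a<..<b} s * ennreal (h s))"
      using ab source_le[OF w, of s M "t - s" x] by (auto simp: indicator_def)
  qed
  also have "\<dots> = ennreal (M powr q) * (\<integral>\<^sup>+s. indicator {a<..<b} s * ennreal (h s) \<partial>lebesgue)"
    by (intro nn_integral_cmult h_window_measurable ab)
  also have "\<dots> = ennreal (M powr q * (H b - H a))"
    using H_nn_integral[of a b] ab by (simp add: ennreal_mult)
  finally show ?thesis .
qed

lemma duhamel_split:
  assumes w: "admissible \<tau> w" and ab: "0 \<le> a" "a \<le> b" "b \<le> \<tau>" "b \<le> t"
  shows "duhamel t b (source \<tau> w) x = duhamel t a (source \<tau> w) x
     + (\<integral>\<^sup>+s. indicator {a<..<b} s * nheat (t - s) (source \<tau> w s) x \<partial>lebesgue)"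
proof -
  have "duhamel t b (source \<tau> w) x = (\<integral>\<^sup>+s. indicator {0<..<a} s * nheat (t - s) (source \<tau> w s) x
      + indicator {a<..<b} s * nheat (t - s) (source \<tau> w s) x \<partial>lebesgue)"
    unfolding duhamel_def
  proof (rule nn_integral_cong_AE)
    have "AE s in lebesgue. s \<notin> {a}" by (intro AE_not_in) simp
    then show "AE s in lebesgue. indicator {0<..<b} s * nheat (t - s) (source \<tau> w s) x =
        indicator {0<..<a} s * nheat (t - s) (source \<tau> w s) x + indicator {a<..<b} s * nheat (t - s) (source \<tau> w s) x"
      by eventually_elim (use ab in \<open>auto simp: indicator_def\<close>)
  qed
  also have "\<dots> = duhamel t a (source \<tau> w) x
     + (\<integral>\<^sup>+s. indicator {a<..<b} s * nheat (t - s) (source \<tau> w s) x \<partial>lebesgue)"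
    unfolding duhamel_def using ab
    by (intro nn_integral_add nheat_measurable source_measurable w) auto
  finally show ?thesis .
qed

text \<open>The real-valued double integral in the definition of a mild solution is the \<open>[0, \<infinity>]\<close>-valued
  Duhamel integral; the essential bound makes the latter finite.\<close>

lemma mild_integral_eq:
  assumes w: "admissible \<tau> w" and t: "0 < t" "t < \<tau>"
    and M: "AE s in lebesgue. 0 < s \<and> s < \<tau> \<longrightarrow> (\<forall>y. w y s \<le> M)"
  shows "ennreal (LINT s:{0<..<t}|lebesgue. (\<Sum>\<^sub>\<infinity>y. p x y (t - s) * h s * (w y s powr q) * \<mu> y)) = duhamel t t (source \<tau> w) x"
    and "duhamel t t (source \<tau> w) x \<le> ennreal (M powr q * H t)"
proof -
  show le: "duhamel t t (source \<tau> w) x \<le> ennreal (M powr q * H t)"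
  proof -
    have "AE s in lebesgue. 0 < s \<and> s < t \<longrightarrow> (\<forall>y. w y s \<le> M)"
      using M by eventually_elim (use t in auto)
    then show ?thesis
      using duhamel_window_le[OF w, of 0 t t M x] t H_0 unfolding duhamel_def by simp
  qed
  let ?g = "\<lambda>s. indicator {0<..<t} s * nheat (t - s) (source \<tau> w s) x"
  have m: "?g \<in> borel_measurable lebesgue"
    by (intro nheat_measurable source_measurable w) auto
  have "indicator {0<..<t} s *\<^sub>R (\<Sum>\<^sub>\<infinity>y. p x y (t - s) * h s * (w y s powr q) * \<mu> y) = enn2real (?g s)" for s
  proof (cases "s \<in> {0<..<t}")
    case True
    have "(\<Sum>\<^sub>\<infinity>y. p x y (t - s) * h s * (w y s powr q) * \<mu> y)
        = enn2real (\<integral>\<^sup>+y. ennreal (p x y (t - s) * h s * (w y s powr q) * \<mu> y) \<partial>count_space UNIV)"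
      using True h_nonneg[of s] by (intro infsum_eq_enn2real_nn_integral) (auto intro!: mult_nonneg_nonneg kernel_nonneg simp: less_imp_le[OF measure_pos])
    also have "(\<integral>\<^sup>+y. ennreal (p x y (t - s) * h s * (w y s powr q) * \<mu> y) \<partial>count_space UNIV) = nheat (t - s) (source \<tau> w s) x"
      unfolding nheat_def
    proof (rule nn_integral_cong)
      fix y
      have "source \<tau> w s y = ennreal (h s * w y s powr q)" using True t by (simp add: source_def)
      moreover have "p x y (t - s) * h s * (w y s powr q) * \<mu> y = (p x y (t - s) * \<mu> y) * (h s * w y s powr q)"
        by simp
      moreover have "ennreal \<dots> = ennreal (p x y (t - s) * \<mu> y) * ennreal (h s * w y s powr q)"
        using True h_nonneg[of s] by (intro ennreal_mult) (auto intro!: weight_kernel_nonneg)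
      ultimately show "ennreal (p x y (t - s) * h s * (w y s powr q) * \<mu> y) = ennreal (p x y (t - s) * \<mu> y) * source \<tau> w s y"
        by (simp only:)
    qed
    finally show ?thesis using True by simp
  qed simp
  then have "(LINT s:{0<..<t}|lebesgue. (\<Sum>\<^sub>\<infinity>y. p x y (t - s) * h s * (w y s powr q) * \<mu> y)) = (LINT s|lebesgue. enn2real (?g s))"
    unfolding set_lebesgue_integral_def by (intro Bochner_Integration.integral_cong) auto
  also have "\<dots> = enn2real (\<integral>\<^sup>+s. ennreal (enn2real (?g s)) \<partial>lebesgue)"
    using m by (intro integral_eq_nn_integral) auto
  also have "(\<integral>\<^sup>+s. ennreal (enn2real (?g s)) \<partial>lebesgue) = (\<integral>\<^sup>+s. ?g s \<partial>lebesgue)"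
  proof (rule nn_integral_cong_AE)
    have "(\<integral>\<^sup>+s. ?g s \<partial>lebesgue) \<noteq> \<infinity>"
      using le unfolding duhamel_def by (auto simp: top_unique)
    from nn_integral_PInf_AE[OF m this]
    show "AE s in lebesgue. ennreal (enn2real (?g s)) = ?g s"
      by eventually_elim (auto simp: less_top)
  qed
  finally show "ennreal (LINT s:{0<..<t}|lebesgue. (\<Sum>\<^sub>\<infinity>y. p x y (t - s) * h s * (w y s powr q) * \<mu> y)) = duhamel t t (source \<tau> w) x"
    using neq_top_trans[OF ennreal_neq_top le] by (simp add: duhamel_def[symmetric] ennreal_enn2real_if)
qed

lemma mild_rhs_eq:
  fixes x :: 'a
  assumes w: "admissible \<tau> w" and t: "0 < t" "t < \<tau>"
    and M: "AE s in lebesgue. 0 < s \<and> s < \<tau> \<longrightarrow> (\<forall>y. w y s \<le> M)"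
  defines "rhs \<equiv> (\<Sum>\<^sub>\<infinity>y. p x y t * u\<^sub>0 y * \<mu> y)
      + (LINT s:{0<..<t}|lebesgue. (\<Sum>\<^sub>\<infinity>y. p x y (t - s) * h s * (w y s powr q) * \<mu> y))"
  shows "ennreal rhs = nheat t (\<lambda>y. ennreal (u\<^sub>0 y)) x + duhamel t t (source \<tau> w) x" and "rhs \<ge> 0"
proof -
  have u0: "ennreal (\<Sum>\<^sub>\<infinity>y. p x y t * u\<^sub>0 y * \<mu> y) = nheat t (\<lambda>y. ennreal (u\<^sub>0 y)) x"
    and u0_nonneg: "(\<Sum>\<^sub>\<infinity>y. p x y t * u\<^sub>0 y * \<mu> y) \<ge> 0"
    using nheat_ennreal[of u\<^sub>0 K\<^sub>0 t x, OF u\<^sub>0_nonneg u\<^sub>0_le t(1)] t u\<^sub>0_nonneg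
    by (auto simp: heat_def ac_simps intro!: infsum_nonneg mult_nonneg_nonneg kernel_nonneg less_imp_le[OF measure_pos])
  have duh_nonneg: "0 \<le> (LINT s:{0<..<t}|lebesgue. (\<Sum>\<^sub>\<infinity>y. p x y (t - s) * h s * (w y s powr q) * \<mu> y))"
    unfolding set_lebesgue_integral_def
    by (intro Bochner_Integration.integral_nonneg)
       (auto simp: indicator_def intro!: infsum_nonneg mult_nonneg_nonneg kernel_nonneg h_nonneg less_imp_le[OF measure_pos])
  show "ennreal rhs = nheat t (\<lambda>y. ennreal (u\<^sub>0 y)) x + duhamel t t (source \<tau> w) x"
    unfolding rhs_def mild_integral_eq(1)[OF w t M, symmetric] u0[symmetric]
    by (rule ennreal_plus[OF u0_nonneg duh_nonneg])
  show "rhs \<ge> 0" unfolding rhs_def by (rule add_nonneg_nonneg[OF u0_nonneg duh_nonneg])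
qed

lemma AE_bound_iff:
  fixes w :: "'a \<Rightarrow> real \<Rightarrow> real"
  shows "(AE t in lebesgue_on {0<..<\<tau>}. linf_norm (\<lambda>x. w x t) \<le> ereal M) \<longleftrightarrow>
   (AE s in lebesgue. 0 < s \<and> s < \<tau> \<longrightarrow> (\<forall>y. \<bar>w y s\<bar> \<le> M))"
  by (subst AE_restrict_space_iff) (auto simp: linf_norm_le_iff)

text \<open>The essential bound of a mild solution is upgraded to a bound at every time, since the equation
  holds at every time and does not see null sets of times.\<close>

lemma mild_solutionD:
  assumes "mild_solution \<mu> p h q u\<^sub>0 \<tau> w"
  obtains M where "M \<ge> 0" "admissible \<tau> w" "\<And>x t. 0 < t \<Longrightarrow> t < \<tau> \<Longrightarrow> w x t \<le> M"
    "\<And>x t. 0 < t \<Longrightarrow> t < \<tau> \<Longrightarrow> ennreal (w x t) = nheat t (\<lambda>y. ennreal (u\<^sub>0 y)) x + duhamel t t (source \<tau> w) x"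
proof -
  from assms obtain M where M: "AE t in lebesgue_on {0<..<\<tau>}. linf_norm (\<lambda>x. w x t) \<le> ereal M"
    and adm: "admissible \<tau> w"
    and eq: "\<And>x t. 0 < t \<Longrightarrow> t < \<tau> \<Longrightarrow> w x t = (\<Sum>\<^sub>\<infinity>y. p x y t * u\<^sub>0 y * \<mu> y)
              + (LINT s:{0<..<t}|lebesgue. (\<Sum>\<^sub>\<infinity>y. p x y (t - s) * h s * (w y s powr q) * \<mu> y))"
    unfolding mild_solution_def admissible_def by auto
  have M': "AE s in lebesgue. 0 < s \<and> s < \<tau> \<longrightarrow> (\<forall>y. w y s \<le> M)"
    using M unfolding AE_bound_iff by eventually_elim (auto dest: abs_le_D1)
  have eq': "ennreal (w x t) = nheat t (\<lambda>y. ennreal (u\<^sub>0 y)) x + duhamel t t (source \<tau> w) x" if "0 < t" "t < \<tau>" for x t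
    unfolding eq[OF that] by (rule mild_rhs_eq(1)[OF adm that M'])
  have bound: "w x t \<le> K\<^sub>0 + M powr q * H \<tau>" if t: "0 < t" "t < \<tau>" for x t
  proof -
    have "H t \<le> H \<tau>" using t by (intro H_nn_integral) auto
    then have le: "M powr q * H t \<le> M powr q * H \<tau>" by (intro mult_left_mono) auto
    have "ennreal (w x t) \<le> ennreal K\<^sub>0 + ennreal (M powr q * H t)"
      unfolding eq'[OF t]
      by (intro add_mono nheat_le[OF t(1)] ennreal_leI u\<^sub>0_le mild_integral_eq(2)[OF adm t M'])
    also have "\<dots> = ennreal (K\<^sub>0 + M powr q * H t)"
      using K\<^sub>0_nonneg H_nonneg t by (simp add: ennreal_plus)
    finally show ?thesis
      using K\<^sub>0_nonneg H_nonneg[of t] t le by (subst (asm) ennreal_le_iff) auto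
  qed
  show ?thesis
  proof (rule that[of "max 0 (K\<^sub>0 + M powr q * H \<tau>)"])
    show "w x t \<le> max 0 (K\<^sub>0 + M powr q * H \<tau>)" if "0 < t" "t < \<tau>" for x t
      using bound[OF that, of x] by linarith
  qed (use adm eq' in auto)
qed

lemma mild_solutionI:
  assumes adm: "admissible \<tau> w" and M: "\<And>x t. 0 < t \<Longrightarrow> t < \<tau> \<Longrightarrow> w x t \<le> M"
    and eq: "\<And>x t. 0 < t \<Longrightarrow> t < \<tau> \<Longrightarrow> ennreal (w x t) = nheat t (\<lambda>y. ennreal (u\<^sub>0 y)) x + duhamel t t (source \<tau> w) x"
  shows "mild_solution \<mu> p h q u\<^sub>0 \<tau> w"
  unfolding mild_solution_def
proof (intro conjI allI ballI exI[of _ M])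
  show "AE t in lebesgue_on {0<..<\<tau>}. linf_norm (\<lambda>x. w x t) \<le> ereal M"
    unfolding AE_bound_iff using M adm by (auto simp: admissible_def)
  have M': "AE s in lebesgue. 0 < s \<and> s < \<tau> \<longrightarrow> (\<forall>y. w y s \<le> M)"
    using M by auto
  fix x t assume t: "t \<in> {0<..<\<tau>}"
  then have t: "0 < t" "t < \<tau>" by auto
  show "w x t = (\<Sum>\<^sub>\<infinity>y. p x y t * u\<^sub>0 y * \<mu> y)
              + (LINT s:{0<..<t}|lebesgue. (\<Sum>\<^sub>\<infinity>y. p x y (t - s) * h s * (w y s powr q) * \<mu> y))" (is "_ = ?rhs")
  proof -
    have "ennreal (w x t) = ennreal ?rhs"
      unfolding eq[OF t] by (rule mild_rhs_eq(1)[OF adm t M', symmetric])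
    moreover have "w x t \<ge> 0" using adm t by (simp add: admissible_def)
    ultimately show ?thesis using mild_rhs_eq(2)[OF adm t M', of x] by (subst (asm) ennreal_inj) auto
  qed
qed (use adm in \<open>auto simp: admissible_def\<close>)

section \<open>Nonexistence of global solutions\<close>

text \<open>Fix a later time \<open>S\<close> and let \<open>J(t)\<close> be the contribution at \<open>(x,S)\<close> of the initial datum and of the
  sources up to time \<open>t\<close>. By \<open>nheat_restart\<close> it is at most the value at \<open>x\<close> of the heat flow of
  \<open>w(t)\<close> over the remaining time \<open>S - t\<close>, so Jensen's inequality yields \<open>J' \<ge> h J\<^sup>q\<close> in
  integrated form, and \<open>J(0)\<close> is the free heat flow.\<close>

lemma mild_lower_bound:
  assumes mild: "mild_solution \<mu> p h q u\<^sub>0 \<tau> w" and T: "0 \<le> T" "T < \<tau>" "T < S"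
    and pos: "heat S u\<^sub>0 x > 0"
  shows "H T \<le> 2 / (q - 1) * heat S u\<^sub>0 x powr (1 - q)"
proof -
  from mild obtain M where M: "M \<ge> 0" and adm: "admissible \<tau> w"
    and le: "\<And>x t. 0 < t \<Longrightarrow> t < \<tau> \<Longrightarrow> w x t \<le> M"
    and eq: "\<And>x t. 0 < t \<Longrightarrow> t < \<tau> \<Longrightarrow> ennreal (w x t) = nheat t (\<lambda>y. ennreal (u\<^sub>0 y)) x + duhamel t t (source \<tau> w) x"
    by (rule mild_solutionD) blast
  define W where "W a b = (\<integral>\<^sup>+s. indicator {a<..<b} s * nheat (S - s) (source \<tau> w s) x \<partial>lebesgue)" for a b
  have S: "S > 0" using T by simp
  have W_le: "W a b \<le> ennreal (M powr q * (H b - H a))" if "0 \<le> a" "a \<le> b" "b \<le> T" for a b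
    unfolding W_def using that T le by (intro duhamel_window_le adm) auto
  have W_add: "W 0 b = W 0 a + W a b" if "0 \<le> a" "a \<le> b" "b \<le> T" for a b
    using duhamel_split[OF adm that(1,2), of S x] that T unfolding W_def duhamel_def by simp
  have fin: "W a b = ennreal (enn2real (W a b))" if "0 \<le> a" "a \<le> b" "b \<le> T" for a b
    using neq_top_trans[OF ennreal_neq_top W_le[OF that]] by (simp add: ennreal_enn2real_if)
  define J where "J t = heat S u\<^sub>0 x + enn2real (W 0 t)" for t
  have J: "ennreal (J t) = nheat S (\<lambda>y. ennreal (u\<^sub>0 y)) x + W 0 t" if "0 \<le> t" "t \<le> T" for t
    unfolding J_def using pos fin[of 0 t] that
    by (simp add: nheat_ennreal[of u\<^sub>0 K\<^sub>0 S x, OF u\<^sub>0_nonneg u\<^sub>0_le S] ennreal_plus)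
  have J_diff: "J b - J a = enn2real (W a b)" if "0 \<le> a" "a \<le> b" "b \<le> T" for a b
  proof -
    have "W 0 a < top" "W a b < top"
      using fin[of 0 a] fin[OF that] that by (metis order.trans ennreal_less_top order_refl)+
    then have "enn2real (W 0 b) = enn2real (W 0 a) + enn2real (W a b)"
      unfolding W_add[OF that] by (rule enn2real_plus)
    then show ?thesis by (simp add: J_def)
  qed
  have J_pos: "J t > 0" for t
    unfolding J_def using pos by (simp add: add_pos_nonneg)
  have J_mono: "J a \<le> J b" if "0 \<le> a" "a \<le> b" "b \<le> T" for a b
    using J_diff[OF that] enn2real_nonneg[of "W a b"] by linarith
  have W_ge: "ennreal (J a powr q * (H b - H a)) \<le> W a b" if ab: "0 \<le> a" "a \<le> b" "b \<le> T" for a b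
  proof -
    have "ennreal (J a powr q * (H b - H a)) = ennreal (J a powr q) * (\<integral>\<^sup>+s. indicator {a<..<b} s * ennreal (h s) \<partial>lebesgue)"
      using H_nn_integral[of a b] ab by (simp add: ennreal_mult)
    also have "\<dots> = (\<integral>\<^sup>+s. ennreal (J a powr q) * (indicator {a<..<b} s * ennreal (h s)) \<partial>lebesgue)"
      using h_window_measurable[of a b] ab by (intro nn_integral_cmult[symmetric]) auto
    also have "\<dots> \<le> W a b"
      unfolding W_def
    proof (rule nn_integral_mono)
      fix s
      show "ennreal (J a powr q) * (indicator {a<..<b} s * ennreal (h s)) \<le> indicator {a<..<b} s * nheat (S - s) (source \<tau> w s) x"
      proof (cases "s \<in> {a<..<b}")
        case True
        then have s: "0 < s" "s < \<tau>" "s < S" "s \<le> T" using ab T by auto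
        have nn: "w y s \<ge> 0" for y using adm s by (simp add: admissible_def)
        have "ennreal (J a) \<le> ennreal (J s)" using J_mono[of a s] True ab by (intro ennreal_leI) auto
        also have "\<dots> = nheat S (\<lambda>y. ennreal (u\<^sub>0 y)) x + duhamel S s (source \<tau> w) x"
          using J[of s] s by (simp add: W_def duhamel_def)
        also have "\<dots> \<le> nheat (S - s) (\<lambda>y. nheat s (\<lambda>y. ennreal (u\<^sub>0 y)) y + duhamel s s (source \<tau> w) y) x"
          using s by (intro nheat_restart source_measurable adm) auto
        also have "\<dots> = nheat (S - s) (\<lambda>y. ennreal (w y s)) x"
          using s by (simp add: eq)
        finally have "ennreal (J a powr q) \<le> nheat (S - s) (\<lambda>y. ennreal (w y s powr q)) x"
          using s nn J_pos[of a] by (intro nheat_jensen q) (auto simp: less_imp_le)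
        then have "ennreal (h s) * ennreal (J a powr q) \<le> ennreal (h s) * nheat (S - s) (\<lambda>y. ennreal (w y s powr q)) x"
          by (intro mult_left_mono) auto
        also have "\<dots> = nheat (S - s) (source \<tau> w s) x"
          using s h_nonneg[of s] by (subst nheat_cmult[symmetric]) (simp add: source_def[abs_def] ennreal_mult)
        finally show ?thesis using True by (simp add: mult.commute)
      qed simp
    qed
    finally show ?thesis .
  qed
  have "H T - H 0 \<le> 2 / (q - 1) * J 0 powr (1 - q)"
  proof (rule blowup_inequality[where C = "M powr q"])
    fix a b assume ab: "0 \<le> a" "a \<le> b" "b \<le> T"
    show "H a \<le> H b" using H_nn_integral(2) ab by simp
    then have nn: "0 \<le> H b - H a" by simp
    have "ennreal (J a powr q * (H b - H a)) \<le> ennreal (J b - J a)"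
      using W_ge[OF ab] fin[OF ab] J_diff[OF ab] by simp
    then show "J a powr q * (H b - H a) \<le> J b - J a"
      using J_mono[OF ab] by (subst (asm) ennreal_le_iff) auto
    have "ennreal (J b - J a) \<le> ennreal (M powr q * (H b - H a))"
      using W_le[OF ab] fin[OF ab] J_diff[OF ab] by simp
    then show "J b - J a \<le> M powr q * (H b - H a)"
      using nn by (subst (asm) ennreal_le_iff) auto
  qed (use T q J_pos H_continuous in auto)
  moreover have "J 0 = heat S u\<^sub>0 x" by (simp add: J_def W_def)
  ultimately show ?thesis by (simp add: H_0)
qed

text \<open>For a global solution \<open>mild_lower_bound\<close> holds for all times, so the growth of \<open>H\<close> forces the
  free heat flow, and with it the kernel, to decay like \<open>o(e\<^bsup>-\<Lambda>t\<^esup>)\<close>. The observation time is kept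
  one unit ahead of the source time.\<close>

lemma no_global_solution:
  assumes y: "u\<^sub>0 y \<noteq> 0"
    and R: "filterlim (\<lambda>t. H t powr (1 / (q - 1)) / exp (\<Lambda> * t)) at_top at_top"
    and mild: "\<And>\<tau>. \<tau> > 0 \<Longrightarrow> mild_solution \<mu> p h q u\<^sub>0 \<tau> w"
  shows "\<Lambda> \<le> bottom_spectrum \<omega> \<mu>"
proof (rule bottom_spectrum_ge_of_decay)
  fix x
  define c where "c = \<mu> y * u\<^sub>0 y"
  have c: "c > 0" using y u\<^sub>0_nonneg[of y] measure_pos[of y] by (simp add: c_def)
  define k where "k = (2 / (q - 1)) powr (1 / (q - 1))"
  let ?R = "\<lambda>t. H t powr (1 / (q - 1)) / exp (\<Lambda> * t)"
  have key: "exp (\<Lambda> * S) * p x y S \<le> exp \<Lambda> * k / c / ?R (S - 1)" if S: "S \<ge> 1" and Rpos: "?R (S - 1) > 0" for S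
  proof -
    define A where "A = heat S u\<^sub>0 x"
    have pA: "p x y S * c \<le> A"
    proof -
      have "ennreal (p x y S * \<mu> y) * ennreal (u\<^sub>0 y) \<le> nheat S (\<lambda>y. ennreal (u\<^sub>0 y)) x" by (rule nheat_ge)
      also have "\<dots> = ennreal A" unfolding A_def
        using S by (intro nheat_ennreal[of u\<^sub>0 K\<^sub>0] u\<^sub>0_nonneg u\<^sub>0_le) auto
      finally have "ennreal (p x y S * c) \<le> ennreal A"
        using S u\<^sub>0_nonneg weight_kernel_nonneg[of S x y] by (simp add: ennreal_mult[symmetric] c_def mult.assoc)
      moreover have "A \<ge> 0" unfolding A_def heat_def
        using S by (intro infsum_nonneg mult_nonneg_nonneg weight_kernel_nonneg u\<^sub>0_nonneg) auto
      ultimately show ?thesis by (simp add: ennreal_le_iff)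
    qed
    have "p x y S * c > 0" using c kernel_pos S by simp
    with pA have Apos: "A > 0" by simp
    have Hpos: "H (S - 1) > 0"
      using Rpos H_nonneg[of "S - 1"] S by (auto simp: less_le)
    have "H (S - 1) \<le> 2 / (q - 1) * A powr (1 - q)"
      using mild_lower_bound[of S w "S - 1" S x] mild[of S] S Apos unfolding A_def by simp
    then have "H (S - 1) powr (1 / (q - 1)) \<le> (2 / (q - 1) * A powr (1 - q)) powr (1 / (q - 1))"
      using Hpos q by (intro powr_mono2) auto
    also have "\<dots> = k * A powr ((1 - q) * (1 / (q - 1)))"
      unfolding k_def by (subst powr_mult) (simp only: powr_powr)
    also have "(1 - q) * (1 / (q - 1)) = -1" using q by (simp add: field_simps)
    also have "A powr -1 = 1 / A" using Apos by (simp add: powr_minus_divide)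
    finally have HA: "H (S - 1) powr (1 / (q - 1)) \<le> k / A" by simp
    have Hp: "H (S - 1) powr (1 / (q - 1)) > 0" using Hpos by simp
    have "A \<le> k / H (S - 1) powr (1 / (q - 1))"
      using HA Hp Apos by (simp add: field_simps)
    with pA have "p x y S * c \<le> k / H (S - 1) powr (1 / (q - 1))" by simp
    then have "p x y S \<le> k / c / H (S - 1) powr (1 / (q - 1))"
      using c Hp by (simp add: field_simps)
    then have "exp (\<Lambda> * S) * p x y S \<le> exp (\<Lambda> * S) * (k / c / H (S - 1) powr (1 / (q - 1)))"
      by (intro mult_left_mono) auto
    also have "\<dots> = exp \<Lambda> * k / c / ?R (S - 1)"
    proof -
      have "exp (\<Lambda> * S) = exp \<Lambda> * exp (\<Lambda> * (S - 1))" by (simp add: exp_add[symmetric] algebra_simps)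
      then show ?thesis by simp
    qed
    finally show ?thesis .
  qed
  have shift: "filterlim (\<lambda>S. ?R (S - 1)) at_top at_top"
    using filterlim_compose[OF R, of "\<lambda>S. S - 1" at_top] filterlim_tendsto_add_at_top[OF tendsto_const[of "-1 :: real"] filterlim_ident]
    by simp
  have lim: "((\<lambda>S. exp \<Lambda> * k / c / ?R (S - 1)) \<longlongrightarrow> 0) at_top"
    by (rule tendsto_divide_0[OF tendsto_const filterlim_at_top_imp_at_infinity[OF shift]])
  show "((\<lambda>t. exp (\<Lambda> * t) * p x y t) \<longlongrightarrow> 0) at_top"
  proof (rule tendsto_sandwich[OF _ _ tendsto_const lim])
    show "\<forall>\<^sub>F S in at_top. 0 \<le> exp (\<Lambda> * S) * p x y S"
      using eventually_gt_at_top[of "0::real"] by eventually_elim (auto simp: kernel_nonneg)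
    have "\<forall>\<^sub>F S in at_top. ?R (S - 1) > 0"
      using shift by (rule filterlim_at_top_dense[THEN iffD1, rule_format])
    with eventually_ge_at_top[of "1::real"]
    show "\<forall>\<^sub>F S in at_top. exp (\<Lambda> * S) * p x y S \<le> exp \<Lambda> * k / c / ?R (S - 1)"
      by eventually_elim (rule key)
  qed
qed

section \<open>Continuation of bounded solutions\<close>

text \<open>A solution bounded by \<open>M\<close> at time \<open>r\<close> stays below \<open>2M\<close> as long as \<open>h\<close> has little mass left.
  Restarted at \<open>r\<close>, the equation bounds \<open>w(s)\<close> by \<open>M\<close>, plus at most \<open>M/2\<close> from the sources in
  \<open>(r,a)\<close> if the bound \<open>2M\<close> is known up to \<open>a\<close>, plus at most \<open>M/2\<close> from the sources in \<open>(a,s)\<close>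
  if \<open>s\<close> is so close to \<open>a\<close> that the mass of \<open>h\<close> on \<open>(a,s)\<close> compensates a crude bound \<open>B\<close>
  of \<open>w\<close>. Bolzano's lemma propagates the bound \<open>2M\<close>.\<close>

lemma local_bound:
  assumes mild: "\<And>\<tau>'. 0 < \<tau>' \<Longrightarrow> \<tau>' < \<tau> \<Longrightarrow> mild_solution \<mu> p h q u\<^sub>0 \<tau>' w"
    and r: "0 < r" "r < \<tau>" and M: "M > 0" "\<And>x. w x r \<le> M"
    and small: "(2 * M) powr q * (H \<tau> - H r) \<le> M / 2"
    and t: "r \<le> t" "t < \<tau>"
  shows "w x t \<le> 2 * M"
proof -
  define \<tau>' where "\<tau>' = (t + \<tau>) / 2"
  have \<tau>': "t < \<tau>'" "\<tau>' < \<tau>" "0 < \<tau>'" using t r by (auto simp: \<tau>'_def)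
  from mild[OF \<tau>'(3,2)] obtain B where B: "B \<ge> 0" and adm: "admissible \<tau>' w"
    and le: "\<And>x t. 0 < t \<Longrightarrow> t < \<tau>' \<Longrightarrow> w x t \<le> B"
    and eq: "\<And>x t. 0 < t \<Longrightarrow> t < \<tau>' \<Longrightarrow> ennreal (w x t) = nheat t (\<lambda>y. ennreal (u\<^sub>0 y)) x + duhamel t t (source \<tau>' w) x"
    by (rule mild_solutionD) blast
  define Q where "Q a b \<longleftrightarrow> (r \<le> a \<and> b \<le> t \<and> (\<forall>s\<in>{r..a}. \<forall>x. w x s \<le> 2 * M) \<longrightarrow> (\<forall>s\<in>{r..b}. \<forall>x. w x s \<le> 2 * M))" for a b
  have step: "w x s \<le> 2 * M"
    if a: "r \<le> a" "a \<le> s" "s \<le> t" "B powr q * (H s - H a) \<le> M / 2" and bnd: "\<forall>s\<in>{r..a}. \<forall>x. w x s \<le> 2 * M" for a s x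
  proof (cases "r < s")
    case True
    let ?W = "\<lambda>a b. \<integral>\<^sup>+\<sigma>. indicator {a<..<b} \<sigma> * nheat (s - \<sigma>) (source \<tau>' w \<sigma>) x \<partial>lebesgue"
    have s: "0 < s" "s < \<tau>'" using True r a \<tau>' by auto
    have Hm: "H r \<le> H a" "H a \<le> H \<tau>" "H a \<le> H s" using a r t \<tau>' s by (auto intro!: H_nn_integral(2))
    have "duhamel s s (source \<tau>' w) x = duhamel s a (source \<tau>' w) x + ?W a s"
      using a r s by (intro duhamel_split adm) auto
    also have "duhamel s a (source \<tau>' w) x = duhamel s r (source \<tau>' w) x + ?W r a"
      using a r s by (intro duhamel_split adm) auto
    finally have "ennreal (w x s) = (nheat s (\<lambda>y. ennreal (u\<^sub>0 y)) x + duhamel s r (source \<tau>' w) x) + ?W r a + ?W a s"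
      by (simp add: eq s add.assoc)
    also have "\<dots> \<le> ennreal M + ennreal (M / 2) + ennreal (M / 2)"
    proof (intro add_mono)
      have "nheat s (\<lambda>y. ennreal (u\<^sub>0 y)) x + duhamel s r (source \<tau>' w) x
          \<le> nheat (s - r) (\<lambda>y. nheat r (\<lambda>y. ennreal (u\<^sub>0 y)) y + duhamel r r (source \<tau>' w) y) x"
        using True r by (intro nheat_restart source_measurable adm) auto
      also have "\<dots> = nheat (s - r) (\<lambda>y. ennreal (w y r)) x"
        using r True s by (simp add: eq)
      also have "\<dots> \<le> ennreal M" using True M by (intro nheat_le ennreal_leI) auto
      finally show "nheat s (\<lambda>y. ennreal (u\<^sub>0 y)) x + duhamel s r (source \<tau>' w) x \<le> ennreal M" .
      have "?W r a \<le> ennreal ((2 * M) powr q * (H a - H r))"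
        using a r s bnd by (intro duhamel_window_le adm) auto
      also have "\<dots> \<le> ennreal (M / 2)"
        using Hm by (intro ennreal_leI order_trans[OF mult_left_mono small]) auto
      finally show "?W r a \<le> ennreal (M / 2)" .
      have "?W a s \<le> ennreal (B powr q * (H s - H a))"
        using a r s le by (intro duhamel_window_le adm) auto
      also have "\<dots> \<le> ennreal (M / 2)" using a by (intro ennreal_leI)
      finally show "?W a s \<le> ennreal (M / 2)" .
    qed
    also have "\<dots> = ennreal (2 * M)" using M by (simp add: ennreal_plus[symmetric] del: ennreal_plus)
    finally show ?thesis using M by (subst (asm) ennreal_le_iff) auto
  next
    case False
    then show ?thesis using a M(1) M(2)[of x] by (cases "s = r") auto
  qed
  have "Q r t"
    using t(1)
  proof (induction rule: Bolzano)
    case (trans a b c)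
    show ?case
      unfolding Q_def
    proof (intro impI, elim conjE)
      assume *: "r \<le> a" "c \<le> t" "\<forall>s\<in>{r..a}. \<forall>x. w x s \<le> 2 * M"
      then have "\<forall>s\<in>{r..b}. \<forall>x. w x s \<le> 2 * M"
        using trans(1)[unfolded Q_def] trans(4) by linarith
      then show "\<forall>s\<in>{r..c}. \<forall>x. w x s \<le> 2 * M"
        using trans(2)[unfolded Q_def] trans(3) * by linarith
    qed
  next
    case (local y)
    \<comment> \<open>\<open>+ 1\<close> because \<open>B\<close> may be 0\<close>
    define e where "e = M / (2 * (B powr q + 1))"
    have e: "e > 0" "B powr q * e \<le> M / 2"
    proof -
      have "B powr q + 1 > 0" by (simp add: add_nonneg_pos)
      then show "e > 0" "B powr q * e \<le> M / 2" using M by (auto simp: e_def field_simps)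
    qed
    obtain d where d: "d > 0" "\<And>a b. 0 \<le> a \<Longrightarrow> a \<le> y \<Longrightarrow> y \<le> b \<Longrightarrow> b \<le> t \<Longrightarrow> b - a < d \<Longrightarrow> H b - H a < e"
      using continuous_on_increment_small[OF H_continuous, of y t e] local r e by auto
    show ?case
    proof (intro exI[of _ d] conjI allI impI d(1))
      fix a b assume ab: "a \<le> y \<and> y \<le> b \<and> b - a < d"
      show "Q a b" unfolding Q_def
      proof (intro impI ballI allI, elim conjE)
        fix s x assume *: "s \<in> {r..b}" "r \<le> a" "b \<le> t" "\<forall>s\<in>{r..a}. \<forall>x. w x s \<le> 2 * M"
        show "w x s \<le> 2 * M"
        proof (cases "s \<le> a")
          case False
          have "H s - H a \<le> H b - H a" using * r by (auto intro!: H_nn_integral(2))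
          also have "\<dots> \<le> e" using d(2)[of a b] ab * r by auto
          finally have "B powr q * (H s - H a) \<le> B powr q * e" by (intro mult_left_mono) auto
          with e(2) have "B powr q * (H s - H a) \<le> M / 2" by linarith
          with False * show ?thesis by (intro step[of a s]) auto
        qed (use * in auto)
      qed
    qed
  qed
  then show ?thesis
    unfolding Q_def using M r t by (metis (no_types, lifting) atLeastAtMost_iff order_refl order_antisym mult_2 add_increasing less_imp_le)
qed

text \<open>A maximal solution is given as a solution on each \<open>(0,\<tau>')\<close> with \<open>\<tau>' < \<tau>\<close>; measurability passes to
  \<open>(0,\<tau>)\<close> because countably many of these intervals exhaust it.\<close>

lemma admissible_Union:
  assumes "\<And>\<tau>'. 0 < \<tau>' \<Longrightarrow> \<tau>' < \<tau> \<Longrightarrow> admissible \<tau>' w" "\<tau> > 0"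
  shows "admissible \<tau> w"
  unfolding admissible_def
proof (intro conjI allI ballI)
  fix y s assume s: "s \<in> {0<..<\<tau>}"
  then show "w y s \<ge> 0"
    using assms(1)[of "(s + \<tau>) / 2"] by (auto simp: admissible_def)
next
  fix y
  define T where "T n = \<tau> - \<tau> / (real n + 2)" for n :: nat
  have T: "0 < T n" "T n < \<tau>" for n using assms(2) by (auto simp: T_def field_simps add_pos_nonneg)
  have T_lim: "T \<longlonglongrightarrow> \<tau>"
  proof -
    have "(\<lambda>n. \<tau> - \<tau> * inverse (real (n + 2))) \<longlonglongrightarrow> \<tau> - \<tau> * 0"
      by (intro tendsto_intros LIMSEQ_ignore_initial_segment[OF lim_inverse_n])
    then show ?thesis by (simp add: T_def[abs_def] divide_inverse add.commute)
  qed
  have "(\<lambda>s. indicator {0<..<\<tau>} s *\<^sub>R w y s) \<in> borel_measurable lebesgue"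
  proof (rule borel_measurable_LIMSEQ_real)
    show "(\<lambda>s. indicator {0<..<T n} s *\<^sub>R w y s) \<in> borel_measurable lebesgue" for n
      using assms(1)[OF T, of n] borel_measurable_restrict_space_iff[of "{0<..<T n}" lebesgue "w y"]
      by (simp add: admissible_def)
    fix s :: real
    show "(\<lambda>n. indicator {0<..<T n} s *\<^sub>R w y s) \<longlonglongrightarrow> indicator {0<..<\<tau>} s *\<^sub>R w y s"
    proof (rule tendsto_eventually)
      show "\<forall>\<^sub>F n in sequentially. indicator {0<..<T n} s *\<^sub>R w y s = indicator {0<..<\<tau>} s *\<^sub>R w y s"
      proof (cases "s < \<tau>")
        case True
        from order_tendstoD(1)[OF T_lim this] show ?thesis
          by eventually_elim (use True in \<open>auto simp: indicator_def\<close>)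
      next
        case False
        have "\<not> s < T n" for n using False T(2)[of n] by simp
        then show ?thesis using False by (simp add: indicator_def)
      qed
    qed
  qed
  then show "(\<lambda>s. w y s) \<in> borel_measurable (lebesgue_on {0<..<\<tau>})"
    using borel_measurable_restrict_space_iff[of "{0<..<\<tau>}" lebesgue "w y"] by simp
qed

text \<open>The extension is the limit of monotone iterates of the right-hand side \<open>\<Phi>\<close> of the mild equation,
  started from \<open>w\<close> extended by 0. The iteration leaves \<open>w\<close> fixed on \<open>(0,\<tau>)\<close>, so the limit extends
  \<open>w\<close> automatically, and a short enough additional interval keeps all iterates below a constant \<open>B\<close>.\<close>

lemma bounded_solution_extends:
  assumes mild: "\<And>\<tau>'. 0 < \<tau>' \<Longrightarrow> \<tau>' < \<tau> \<Longrightarrow> mild_solution \<mu> p h q u\<^sub>0 \<tau>' w"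
    and \<tau>: "\<tau> > 0" and K: "K \<ge> 0" "\<And>x t. 0 < t \<Longrightarrow> t < \<tau> \<Longrightarrow> w x t \<le> K"
  obtains \<tau>' v where "\<tau> < \<tau>'" "mild_solution \<mu> p h q u\<^sub>0 \<tau>' v" "\<And>x t. 0 < t \<Longrightarrow> t < \<tau> \<Longrightarrow> v x t = w x t"
proof -
  have adm_w: "admissible \<tau> w"
  proof (rule admissible_Union[OF _ \<tau>])
    show "admissible \<tau>' w" if "0 < \<tau>'" "\<tau>' < \<tau>" for \<tau>'
      using mild[OF that] by (rule mild_solutionD) blast
  qed
  have w_nonneg: "w x t \<ge> 0" if "0 < t" "t < \<tau>" for x t
    using adm_w that by (simp add: admissible_def)
  have eq_w: "ennreal (w x t) = nheat t (\<lambda>y. ennreal (u\<^sub>0 y)) x + duhamel t t (source \<tau> w) x" if t: "0 < t" "t < \<tau>" for x t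
  proof -
    define r where "r = (t + \<tau>) / 2"
    have r: "t < r" "r < \<tau>" "0 < r" using t by (auto simp: r_def)
    have "duhamel t t (source r w) x = duhamel t t (source \<tau> w) x"
      using r by (intro duhamel_cong) (auto simp: source_def)
    moreover have "ennreal (w x t) = nheat t (\<lambda>y. ennreal (u\<^sub>0 y)) x + duhamel t t (source r w) x"
      using mild[OF r(3,2)] t(1) r(1) by (elim mild_solutionD) blast
    ultimately show ?thesis by simp
  qed
  \<comment> \<open>initial datum, sources before \<open>\<tau>\<close>, a unit for the sources after \<open>\<tau>\<close>; \<open>K\<close> for times before \<open>\<tau>\<close>\<close>
  define B where "B = K\<^sub>0 + K powr q * H \<tau> + 1 + K"
  have B: "B \<ge> K" "B \<ge> 0" "B \<ge> K\<^sub>0 + K powr q * H \<tau> + 1"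
    using K\<^sub>0_nonneg K H_nonneg[of \<tau>] \<tau> by (auto simp: B_def)
  obtain d where d: "d > 0" "\<And>a b. 0 \<le> a \<Longrightarrow> a \<le> \<tau> \<Longrightarrow> \<tau> \<le> b \<Longrightarrow> b \<le> \<tau> + 1 \<Longrightarrow> b - a < d \<Longrightarrow> H b - H a < 1 / (B powr q + 1)"
    using continuous_on_increment_small[OF H_continuous, of \<tau> "\<tau> + 1" "1 / (B powr q + 1)"] \<tau>
    by (auto simp: add_nonneg_pos)
  define \<tau>' where "\<tau>' = \<tau> + min 1 (d / 2)"
  have \<tau>': "\<tau> < \<tau>'" "\<tau>' \<le> \<tau> + 1" "\<tau>' - \<tau> < d" using d(1) by (auto simp: \<tau>'_def)
  have small: "B powr q * (H t - H \<tau>) \<le> 1" if "\<tau> \<le> t" "t < \<tau>'" for t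
  proof -
    have "H t - H \<tau> < 1 / (B powr q + 1)" using d(2)[of \<tau> t] \<tau> that \<tau>' by auto
    then have "B powr q * (H t - H \<tau>) \<le> B powr q * (1 / (B powr q + 1))" by (intro mult_left_mono) auto
    also have "\<dots> \<le> 1"
    proof -
      have "B powr q + 1 > 0" by (simp add: add_nonneg_pos)
      then show ?thesis by (simp add: divide_le_eq)
    qed
    finally show ?thesis .
  qed
  define \<Phi> where "\<Phi> f x t = nheat t (\<lambda>y. ennreal (u\<^sub>0 y)) x + duhamel t t (source \<tau>' f) x" for f x t
  define v where "v = rec_nat (\<lambda>x t. if t < \<tau> then w x t else 0) (\<lambda>_ f x t. enn2real (\<Phi> f x t))"
  have v_0: "v 0 x t = (if t < \<tau> then w x t else 0)" for x t by (simp add: v_def)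
  have v_Suc: "v (Suc n) x t = enn2real (\<Phi> (v n) x t)" for n x t by (simp add: v_def)
  have \<Phi>_old: "\<Phi> f x t = ennreal (w x t)" if f: "\<And>y s. 0 < s \<Longrightarrow> s < \<tau> \<Longrightarrow> f y s = w y s" and t: "0 < t" "t < \<tau>" for f x t
  proof -
    have "duhamel t t (source \<tau>' f) x = duhamel t t (source \<tau> w) x"
      using t \<tau>' f by (intro duhamel_cong) (auto simp: source_def)
    then show ?thesis using t by (simp add: \<Phi>_def eq_w)
  qed
  have \<Phi>_le: "\<Phi> f x t \<le> ennreal B"
    if adm: "admissible \<tau>' f" and f: "\<And>y s. 0 < s \<Longrightarrow> s < \<tau> \<Longrightarrow> f y s = w y s"
      and fB: "\<And>y s. 0 < s \<Longrightarrow> s < \<tau>' \<Longrightarrow> f y s \<le> B" and t: "0 < t" "t < \<tau>'" for f x t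
  proof (cases "t < \<tau>")
    case True
    have "w x t \<le> B" using K(2)[OF t(1) True, of x] B(1) by linarith
    then show ?thesis using \<Phi>_old[where f = f, OF f t(1) True] by (simp add: ennreal_leI)
  next
    case False
    have "duhamel t t (source \<tau>' f) x = duhamel t \<tau> (source \<tau>' f) x
       + (\<integral>\<^sup>+s. indicator {\<tau><..<t} s * nheat (t - s) (source \<tau>' f s) x \<partial>lebesgue)"
      using False t \<tau> by (intro duhamel_split adm) auto
    also have "duhamel t \<tau> (source \<tau>' f) x \<le> ennreal (K powr q * (H \<tau> - H 0))"
      unfolding duhamel_def using False t \<tau> \<tau>' f K by (intro duhamel_window_le adm) auto
    also have "(\<integral>\<^sup>+s. indicator {\<tau><..<t} s * nheat (t - s) (source \<tau>' f s) x \<partial>lebesgue) \<le> ennreal (B powr q * (H t - H \<tau>))"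
      using False t \<tau> \<tau>' fB by (intro duhamel_window_le adm) auto
    also have "\<dots> \<le> ennreal 1" using small[of t] False t by (intro ennreal_leI) auto
    finally have "\<Phi> f x t \<le> ennreal K\<^sub>0 + (ennreal (K powr q * (H \<tau> - H 0)) + ennreal 1)"
      unfolding \<Phi>_def using t by (auto intro!: add_mono nheat_le ennreal_leI u\<^sub>0_le)
    also have "\<dots> = ennreal (K\<^sub>0 + K powr q * H \<tau> + 1)"
      using K\<^sub>0_nonneg H_nonneg[of \<tau>] \<tau> by (simp add: H_0 ennreal_plus[symmetric] add.assoc del: ennreal_plus ennreal_1)
    also have "\<dots> \<le> ennreal B" using B by (intro ennreal_leI) auto
    finally show ?thesis .
  qed
  have \<Phi>_meas: "(\<lambda>t. enn2real (\<Phi> f x t)) \<in> borel_measurable (lebesgue_on {0<..<\<tau>'})" if "admissible \<tau>' f" for f x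
  proof -
    have "(\<lambda>t. enn2real (indicator {0<..} t * nheat t (\<lambda>y. ennreal (u\<^sub>0 y)) x + duhamel t t (source \<tau>' f) x)) \<in> borel_measurable lborel"
      using nheat_time_measurable[of "\<lambda>y. ennreal (u\<^sub>0 y)" x] duhamel_measurable[where F = "source \<tau>' f" and x = x, OF source_measurable[OF that]]
      by simp
    then have "(\<lambda>t. enn2real (indicator {0<..} t * nheat t (\<lambda>y. ennreal (u\<^sub>0 y)) x + duhamel t t (source \<tau>' f) x)) \<in> borel_measurable (lebesgue_on {0<..<\<tau>'})"
      by (intro measurable_restrict_space1 measurable_completion)
    then show ?thesis
      by (rule measurable_cong[THEN iffD1, rotated]) (simp add: \<Phi>_def)
  qed
  have inv: "admissible \<tau>' (v n) \<and> (\<forall>x t. 0 < t \<longrightarrow> t < \<tau> \<longrightarrow> v n x t = w x t) \<and> (\<forall>x t. 0 < t \<longrightarrow> t < \<tau>' \<longrightarrow> v n x t \<le> B)" for n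
  proof (induction n)
    case 0
    have m: "(\<lambda>s. v 0 y s) \<in> borel_measurable (lebesgue_on {0<..<\<tau>'})" for y
    proof -
      have "(\<lambda>s. indicator {0<..<\<tau>} s *\<^sub>R w y s) \<in> borel_measurable lebesgue"
        using adm_w borel_measurable_restrict_space_iff[of "{0<..<\<tau>}" lebesgue "w y"] by (simp add: admissible_def)
      moreover have "indicator {0<..<\<tau>'} s *\<^sub>R v 0 y s = indicator {0<..<\<tau>} s *\<^sub>R w y s" for s
        using \<tau>' by (auto simp: v_0 indicator_def)
      ultimately show ?thesis
        using borel_measurable_restrict_space_iff[of "{0<..<\<tau>'}" lebesgue "v 0 y"] by simp
    qed
    have "v 0 x t \<ge> 0" if "t > 0" for x t
      using w_nonneg that by (simp add: v_0)
    with m have "admissible \<tau>' (v 0)" unfolding admissible_def by auto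
    moreover have "v 0 x t \<le> B" if "t > 0" for x t
      using K(2)[of t x] that B by (auto simp: v_0)
    moreover have "v 0 x t = w x t" if "t < \<tau>" for x t
      using that by (simp add: v_0)
    ultimately show ?case by blast
  next
    case (Suc n)
    then have adm: "admissible \<tau>' (v n)" and old: "\<And>y s. 0 < s \<Longrightarrow> s < \<tau> \<Longrightarrow> v n y s = w y s"
      and le: "\<And>y s. 0 < s \<Longrightarrow> s < \<tau>' \<Longrightarrow> v n y s \<le> B" by auto
    have "admissible \<tau>' (v (Suc n))"
      unfolding admissible_def v_Suc using \<Phi>_meas[OF adm] by auto
    moreover have "v (Suc n) x t = w x t" if "0 < t" "t < \<tau>" for x t
      using \<Phi>_old[where f = "v n", OF old that] w_nonneg[OF that] by (simp add: v_Suc)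
    moreover have "v (Suc n) x t \<le> B" if "0 < t" "t < \<tau>'" for x t
      using \<Phi>_le[where f = "v n", OF adm old le that, of x] B(2) unfolding v_Suc by (rule enn2real_leI[rotated])
    ultimately show ?case by blast
  qed
  then have adm: "admissible \<tau>' (v n)" and old: "\<And>y s. 0 < s \<Longrightarrow> s < \<tau> \<Longrightarrow> v n y s = w y s"
    and le: "\<And>y s. 0 < s \<Longrightarrow> s < \<tau>' \<Longrightarrow> v n y s \<le> B" for n by blast+
  have v_\<Phi>: "ennreal (v (Suc n) x t) = \<Phi> (v n) x t" if "0 < t" "t < \<tau>'" for n x t
    using neq_top_trans[OF ennreal_neq_top \<Phi>_le[where f = "v n", OF adm old le that]] by (simp add: v_Suc ennreal_enn2real_if)
  have nn: "v n x t \<ge> 0" if "0 < t" "t < \<tau>'" for n x t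
    using adm that by (simp add: admissible_def)
  have mono: "v n x t \<le> v (Suc n) x t" if "0 < t" "t < \<tau>'" for n x t
    using that
  proof (induction n arbitrary: x t)
    case 0
    then show ?case using old[of t "Suc 0" x] nn[of t "Suc 0" x] by (auto simp: v_0)
  next
    case (Suc n)
    have "\<Phi> (v n) x t \<le> \<Phi> (v (Suc n)) x t"
      unfolding \<Phi>_def
    proof (intro add_left_mono duhamel_mono)
      fix s y assume "0 < s" "s < t"
      then have "h s * v n y s powr q \<le> h s * v (Suc n) y s powr q"
        using Suc.IH[of s y] Suc.prems nn[of s n y] q by (intro mult_left_mono powr_mono2 h_nonneg) auto
      then show "source \<tau>' (v n) s y \<le> source \<tau>' (v (Suc n)) s y"
        unfolding source_def by (intro mult_left_mono[OF ennreal_leI]) auto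
    qed
    then have "ennreal (v (Suc n) x t) \<le> ennreal (v (Suc (Suc n)) x t)"
      using v_\<Phi> Suc.prems by simp
    then show ?case using nn[OF Suc.prems, of "Suc (Suc n)" x] by (subst (asm) ennreal_le_iff) auto
  qed
  define V where "V x t = lim (\<lambda>n. v n x t)" for x t
  have V: "(\<lambda>n. v n x t) \<longlonglongrightarrow> V x t" if t: "0 < t" "t < \<tau>'" for x t
  proof -
    have inc: "incseq (\<lambda>n. v n x t)" using mono[OF t] by (rule incseq_SucI)
    obtain L where "(\<lambda>n. v n x t) \<longlonglongrightarrow> L"
      using le[OF t] by (rule incseq_convergent[OF inc, of B, OF allI]) 
    then show ?thesis unfolding V_def by (simp add: limI)
  qed
  have V_nn: "V x t \<ge> 0" if "0 < t" "t < \<tau>'" for x t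
    using nn[OF that] by (intro LIMSEQ_le_const[OF V[OF that]]) auto
  have V_le: "V x t \<le> B" if "0 < t" "t < \<tau>'" for x t
    using le[OF that] by (intro LIMSEQ_le_const2[OF V[OF that]]) auto
  have V_old: "V x t = w x t" if "0 < t" "t < \<tau>" for x t
    using V[of t x] old[OF that] that \<tau>' by (simp add: LIMSEQ_const_iff)
  have adm_V: "admissible \<tau>' V"
    unfolding admissible_def
  proof (intro conjI allI ballI)
    fix y
    show "(\<lambda>s. V y s) \<in> borel_measurable (lebesgue_on {0<..<\<tau>'})"
      by (rule borel_measurable_LIMSEQ_real[of _ "\<lambda>n. v n y"]) (use V adm in \<open>auto simp: admissible_def\<close>)
  qed (use V_nn in auto)
  have "mild_solution \<mu> p h q u\<^sub>0 \<tau>' V"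
  proof (rule mild_solutionI[OF adm_V V_le])
    fix x t assume t: "0 < t" "t < \<tau>'"
    have "(\<lambda>n. duhamel t t (source \<tau>' (v n)) x) \<longlonglongrightarrow> duhamel t t (source \<tau>' V) x"
    proof (rule duhamel_LIMSEQ[OF source_measurable[OF adm]])
      show "source \<tau>' (v n) s y \<le> source \<tau>' (v (Suc n)) s y" for n s y
      proof (cases "s \<in> {0<..<\<tau>'}")
        case True
        then have "h s * v n y s powr q \<le> h s * v (Suc n) y s powr q"
          using mono[of s n y] nn[of s n y] q by (intro mult_left_mono powr_mono2 h_nonneg) auto
        then show ?thesis unfolding source_def by (intro mult_left_mono[OF ennreal_leI]) auto
      qed (simp add: source_def)
      show "(\<lambda>n. source \<tau>' (v n) s y) \<longlonglongrightarrow> source \<tau>' V s y" for s y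
      proof (cases "s \<in> {0<..<\<tau>'}")
        case True
        then have "(\<lambda>n. ennreal (h s * v n y s powr q)) \<longlonglongrightarrow> ennreal (h s * V y s powr q)"
          using V[of s y] nn[of s _ y] q
          by (intro tendsto_ennrealI tendsto_mult tendsto_const tendsto_powr') auto
        then show ?thesis using True by (simp add: source_def)
      qed (simp add: source_def)
    qed
    then have "(\<lambda>n. \<Phi> (v n) x t) \<longlonglongrightarrow> nheat t (\<lambda>y. ennreal (u\<^sub>0 y)) x + duhamel t t (source \<tau>' V) x"
      unfolding \<Phi>_def by (intro tendsto_add tendsto_const)
    moreover have "(\<lambda>n. \<Phi> (v n) x t) \<longlonglongrightarrow> ennreal (V x t)"
      using LIMSEQ_Suc[OF tendsto_ennrealI[OF V[OF t, of x]]] v_\<Phi>[OF t] by simp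
    ultimately show "ennreal (V x t) = nheat t (\<lambda>y. ennreal (u\<^sub>0 y)) x + duhamel t t (source \<tau>' V) x"
      using LIMSEQ_unique by blast
  qed
  then show ?thesis using that \<tau>'(1) V_old by blast
qed

end

section \<open>Blow-up in finite time\<close>

theorem theorem3p2:
  fixes \<omega> :: "'a \<Rightarrow> 'a \<Rightarrow> real" and \<mu> :: "'a \<Rightarrow> real"
    and p :: "'a \<Rightarrow> 'a \<Rightarrow> real \<Rightarrow> real"
    and q \<epsilon> :: real and u\<^sub>0 :: "'a \<Rightarrow> real" and h H :: "real \<Rightarrow> real"
    and u :: "'a \<Rightarrow> real \<Rightarrow> real" and \<tau>max :: ereal
  assumes "weighted_graph \<omega> \<mu>"
    and "heat_kernel \<omega> \<mu> p"
    and "stochastically_complete \<mu> p"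
    and "bottom_spectrum \<omega> \<mu> > 0"
    and "q > 1"
    and "linf_norm u\<^sub>0 < \<infinity>" and "\<And>x. u\<^sub>0 x \<ge> 0" and "\<exists>x. u\<^sub>0 x \<noteq> 0"
    and "\<And>t. t \<ge> 0 \<Longrightarrow> h t \<ge> 0"
    and "\<And>t. t \<ge> 0 \<Longrightarrow> set_integrable lebesgue {0..t} h"
    and "\<And>t. t \<ge> 0 \<Longrightarrow> H t = (LINT s:{0..t}|lebesgue. h s)"
    and "0 < \<epsilon>" and "\<epsilon> < bottom_spectrum \<omega> \<mu>"
    and "filterlim (\<lambda>t. H t powr (1 / (q - 1)) / exp ((bottom_spectrum \<omega> \<mu> + \<epsilon>) * t)) at_top at_top"
    and "\<tau>max > 0"
    and "maximal_mild_solution \<mu> p h q u\<^sub>0 \<tau>max u"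
  shows "\<tau>max < \<infinity> \<and>
    ((\<lambda>t. linf_norm (\<lambda>x. u x t)) \<longlongrightarrow> \<infinity>) (at_left (real_of_ereal \<tau>max))"
proof -
  obtain K\<^sub>0 where K\<^sub>0: "linf_norm u\<^sub>0 \<le> ereal K\<^sub>0"
    using assms(6) by (cases "linf_norm u\<^sub>0") auto
  interpret problem: semilinear_heat_problem \<omega> \<mu> p h q u\<^sub>0 K\<^sub>0
  proof (intro semilinear_heat_problem.intro complete_heat_graph.intro
      complete_heat_graph_axioms.intro semilinear_heat_problem_axioms.intro)
    show "u\<^sub>0 x \<le> K\<^sub>0" for x
      using K\<^sub>0 by (auto simp: linf_norm_le_iff dest: abs_le_D1)
  qed (use assms in auto)
  have H_eq: "H t = problem.H t" if "t \<ge> 0" for t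
    using assms(11)[OF that] by (simp add: problem.H_def)
  have mild: "mild_solution \<mu> p h q u\<^sub>0 \<tau> u" if "0 < \<tau>" "ereal \<tau> < \<tau>max" for \<tau>
    using assms(16) that by (simp add: maximal_mild_solution_def)
  have finite_time: "\<tau>max < \<infinity>"
  proof (rule ccontr)
    assume "\<not> \<tau>max < \<infinity>"
    then have "\<tau>max = \<infinity>" by simp
    then have mild_all: "mild_solution \<mu> p h q u\<^sub>0 \<tau> u" if "\<tau> > 0" for \<tau>
      using mild[OF that] by simp
    obtain y where y: "u\<^sub>0 y \<noteq> 0" using assms(8) by blast
    let ?\<Lambda> = "bottom_spectrum \<omega> \<mu> + \<epsilon>"
    have "filterlim (\<lambda>t. problem.H t powr (1 / (q - 1)) / exp (?\<Lambda> * t)) at_top at_top"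
    proof (rule filterlim_cong[THEN iffD1, OF refl refl _ assms(14)])
      show "\<forall>\<^sub>F t in at_top. H t powr (1 / (q - 1)) / exp (?\<Lambda> * t) = problem.H t powr (1 / (q - 1)) / exp (?\<Lambda> * t)"
        using eventually_ge_at_top[of "0::real"] by eventually_elim (simp add: H_eq)
    qed
    from problem.no_global_solution[OF y this mild_all] have "?\<Lambda> \<le> bottom_spectrum \<omega> \<mu>" .
    then show False using assms(12) by simp
  qed
  obtain \<tau> where \<tau>: "\<tau>max = ereal \<tau>" "\<tau> > 0"
    using finite_time assms(15) by (cases \<tau>max) auto
  have mild': "mild_solution \<mu> p h q u\<^sub>0 \<tau>' u" if "0 < \<tau>'" "\<tau>' < \<tau>" for \<tau>'
    using mild[of \<tau>'] that \<tau> by simp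
  have unbounded: False if K: "K \<ge> 0" "\<And>x t. 0 < t \<Longrightarrow> t < \<tau> \<Longrightarrow> u x t \<le> K" for K
  proof -
    obtain \<tau>' v where v: "\<tau> < \<tau>'" "mild_solution \<mu> p h q u\<^sub>0 \<tau>' v" "\<And>x t. 0 < t \<Longrightarrow> t < \<tau> \<Longrightarrow> v x t = u x t"
      using problem.bounded_solution_extends[OF mild' \<tau>(2) K] by blast
    have "\<tau>max < ereal \<tau>' \<and> mild_solution \<mu> p h q u\<^sub>0 \<tau>' v \<and>
        (\<forall>x t. 0 < t \<and> ereal t < \<tau>max \<longrightarrow> v x t = u x t)"
      using v \<tau> by simp
    then show False using assms(16) unfolding maximal_mild_solution_def by blast
  qed
  have "((\<lambda>t. linf_norm (\<lambda>x. u x t)) \<longlongrightarrow> \<infinity>) (at_left \<tau>)"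
    unfolding tendsto_PInfty
  proof (rule ccontr)
    assume "\<not> (\<forall>R. \<forall>\<^sub>F t in at_left \<tau>. ereal R < linf_norm (\<lambda>x. u x t))"
    then obtain R where R: "\<exists>\<^sub>F t in at_left \<tau>. linf_norm (\<lambda>x. u x t) \<le> ereal R"
      by (auto simp: not_eventually not_less)
    define M where "M = max 1 R"
    have M: "M > 0" by (simp add: M_def)
    \<comment> \<open>the mass of \<open>h\<close> with which sources of size \<open>(2M)\<^sup>q\<close> contribute \<open>M/2\<close>\<close>
    define e where "e = M / 2 / (2 * M) powr q"
    have e: "e > 0" using M by (simp add: e_def)
    obtain d where d: "d > 0" "\<And>a b. 0 \<le> a \<Longrightarrow> a \<le> \<tau> \<Longrightarrow> \<tau> \<le> b \<Longrightarrow> b \<le> \<tau> \<Longrightarrow> b - a < d \<Longrightarrow> problem.H b - problem.H a < e"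
      using continuous_on_increment_small[OF problem.H_continuous, of \<tau> \<tau> e] \<tau> e by auto
    have "\<forall>\<^sub>F t in at_left \<tau>. t \<in> {max 0 (\<tau> - d)<..<\<tau>}"
      using \<tau> d(1) by (intro eventually_at_left_real) auto
    from frequently_eventually_conj[OF R this]
    obtain r where r: "linf_norm (\<lambda>x. u x r) \<le> ereal R" "0 < r" "\<tau> - d < r" "r < \<tau>"
      by (auto dest!: frequently_ex)
    have rM: "u x r \<le> M" for x
    proof -
      have "\<bar>u x r\<bar> \<le> R" using r(1) unfolding linf_norm_le_iff by blast
      then show ?thesis by (simp add: M_def)
    qed
    have "problem.H \<tau> - problem.H r < e" using d(2)[of r \<tau>] r \<tau> by auto
    then have small: "(2 * M) powr q * (problem.H \<tau> - problem.H r) \<le> M / 2"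
      using M by (simp add: e_def field_simps)
    obtain B where B: "\<And>x t. 0 < t \<Longrightarrow> t < (r + \<tau>) / 2 \<Longrightarrow> u x t \<le> B"
      by (rule problem.mild_solutionD[OF mild'[of "(r + \<tau>) / 2"]]) (use r \<tau> in auto)
    show False
    proof (rule unbounded)
      show "max B (2 * M) \<ge> 0" using M by simp
      fix x t assume t: "0 < t" "t < \<tau>"
      show "u x t \<le> max B (2 * M)"
      proof (cases "t < r")
        case True
        then show ?thesis using B[of t x] t r by simp
      next
        case False
        then show ?thesis using problem.local_bound[OF mild' r(2,4) M rM small, of t x] t by simp
      qed
    qed
  qed
  then show ?thesis using finite_time \<tau> by simp
qed

end
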